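(* Let $N$ be a normal operator in a complex Hilbert space $\mathcal{H}$ such that $\sup\{\operatorname{Re}\lambda : \lambda\in\sigma(N)\}=0$, and let $\alpha,\beta:\mathbb{R}_+\to(0,\infty)$ be real functions such that \[\lim_{t\to\infty}\alpha(t)=\infty\quad\text{and}\quad \lim_{t\to\infty}\beta(t)e^{-t\epsilon}=0\ \text{ for all }\epsilon>0.\] Suppose that the semigroup $(e^{tN})_{t\ge 0}$ is stable. Then \[\mathcal{G}_N(\alpha,\beta):=\{x\in\mathcal{H} : \limsup_{t\to\infty}\alpha(t)\|e^{tN}x\|_{\mathcal{H}}=\infty \ \text{ and }\ \liminf_{t\to\infty}\beta(t)\|e^{tN}x\|_{\mathcal{H}}=0\}\] is a dense $G_\delta$ set in $\mathcal{H}$. Moreover, the assumption on $\beta$ is optimal, that is, $\beta$ cannot be chosen to grow faster than sub-exponentially.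
   Context: $\sigma(N)$ denotes the spectrum of $N$. The semigroup $(e^{tN})_{t\ge0}$ is defined by the spectral functional calculus, $e^{tN}=\int_{\sigma(N)}e^{t\lambda}\,dE^N(\lambda)$, where $E^N$ is the resolution of the identity of $N$; since $\sigma(N)\subset\{\lambda\in\mathbb{C}:\operatorname{Re}\lambda\le0\}$, it is a $C_0$-semigroup of normal contractions generated by $N$. It is called stable if $\lim_{t\to\infty}\|e^{tN}x\|_{\mathcal{H}}=0$ for every $x\in\mathcal{H}$. *)

theory Defs
  imports "HOL-Analysis.Analysis"
begin

text \<open>Complex Hilbert spaces. The inner product is conjugate-linear in its first argument.\<close>

class complex_hilbert_space = banach +
  fixes scaleC :: "complex \<Rightarrow> 'a \<Rightarrow> 'a"  (infixr "*\<^sub>C" 75)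
    and cinner :: "'a \<Rightarrow> 'a \<Rightarrow> complex"
  assumes scaleC_add_right: "a *\<^sub>C (x + y) = a *\<^sub>C x + a *\<^sub>C y"
    and scaleC_add_left: "(a + b) *\<^sub>C x = a *\<^sub>C x + b *\<^sub>C x"
    and scaleC_scaleC: "a *\<^sub>C (b *\<^sub>C x) = (a * b) *\<^sub>C x"
    and scaleC_one: "1 *\<^sub>C x = x"
    and scaleR_scaleC: "r *\<^sub>R x = complex_of_real r *\<^sub>C x"
    and cinner_commute: "cinner x y = cnj (cinner y x)"
    and cinner_add_right: "cinner x (y + z) = cinner x y + cinner x z"
    and cinner_scaleC_right: "cinner x (a *\<^sub>C y) = a * cinner x y"
    and cinner_norm: "cinner x x = complex_of_real ((norm x)\<^sup>2)"


section \<open>Unbounded operators\<close>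

text \<open>An operator with domain \<open>dom N\<close> is a partial function, so that equality of operators
  includes equality of domains and \<open>\<circ>\<^sub>m\<close> is the composition on its natural domain.\<close>

definition linear_operator :: "('a::complex_hilbert_space \<rightharpoonup> 'a) \<Rightarrow> bool" where
  "linear_operator N \<longleftrightarrow>
     N 0 = Some 0 \<and>
     (\<forall>x y u v. N x = Some u \<longrightarrow> N y = Some v \<longrightarrow> N (x + y) = Some (u + v)) \<and>
     (\<forall>a x u. N x = Some u \<longrightarrow> N (a *\<^sub>C x) = Some (a *\<^sub>C u))"

definition is_adjoint_value :: "('a::complex_hilbert_space \<rightharpoonup> 'a) \<Rightarrow> 'a \<Rightarrow> 'a \<Rightarrow> bool" where
  "is_adjoint_value N x z \<longleftrightarrow> (\<forall>y \<in> dom N. cinner x (the (N y)) = cinner z y)"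

definition adjoint_operator ::
    "('a::complex_hilbert_space \<rightharpoonup> 'a) \<Rightarrow> ('a \<rightharpoonup> 'a)" where
  "adjoint_operator N =
     (\<lambda>x. if \<exists>z. is_adjoint_value N x z then Some (THE z. is_adjoint_value N x z) else None)"

definition normal_operator :: "('a::complex_hilbert_space \<rightharpoonup> 'a) \<Rightarrow> bool" where
  "normal_operator N \<longleftrightarrow>
     linear_operator N \<and> closure (dom N) = UNIV \<and> closed (Map.graph N) \<and>
     adjoint_operator N \<circ>\<^sub>m N = N \<circ>\<^sub>m adjoint_operator N"

definition resolvent_set :: "('a::complex_hilbert_space \<rightharpoonup> 'a) \<Rightarrow> complex set" where
  "resolvent_set N =
     {z. bij_betw (\<lambda>x. the (N x) - z *\<^sub>C x) (dom N) UNIV \<and>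
         bounded_linear (inv_into (dom N) (\<lambda>x. the (N x) - z *\<^sub>C x))}"

definition op_spectrum :: "('a::complex_hilbert_space \<rightharpoonup> 'a) \<Rightarrow> complex set" where
  "op_spectrum N = - resolvent_set N"


section \<open>Resolutions of the identity and the spectral functional calculus\<close>

definition orthogonal_projection :: "('a::complex_hilbert_space \<Rightarrow> 'a) \<Rightarrow> bool" where
  "orthogonal_projection P \<longleftrightarrow>
     bounded_linear P \<and> (\<forall>a x. P (a *\<^sub>C x) = a *\<^sub>C P x) \<and>
     (\<forall>x. P (P x) = P x) \<and> (\<forall>x y. cinner (P x) y = cinner x (P y))"

definition projection_valued_measure ::
    "(complex set \<Rightarrow> 'a::complex_hilbert_space \<Rightarrow> 'a) \<Rightarrow> bool" where
  "projection_valued_measure E \<longleftrightarrow>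
     (\<forall>S \<in> sets borel. orthogonal_projection (E S)) \<and>
     (\<forall>x. E {} x = 0) \<and> (\<forall>x. E UNIV x = x) \<and>
     (\<forall>S \<in> sets borel. \<forall>T \<in> sets borel. \<forall>x. E (S \<inter> T) x = E S (E T x)) \<and>
     (\<forall>A :: nat \<Rightarrow> complex set. range A \<subseteq> sets borel \<longrightarrow> disjoint_family A \<longrightarrow>
        (\<forall>x y. (\<lambda>n. cinner x (E (A n) y)) sums cinner x (E (\<Union>n. A n) y)))"

text \<open>The positive measure \<open>E\<^bsub>x,x\<^esub>\<close>, where \<open>E\<^bsub>x,y\<^esub> S = cinner x (E S y)\<close>.\<close>

definition spectral_measure ::
    "(complex set \<Rightarrow> 'a::complex_hilbert_space \<Rightarrow> 'a) \<Rightarrow> 'a \<Rightarrow> complex measure" where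
  "spectral_measure E x = measure_of UNIV (sets borel) (\<lambda>S. ennreal (Re (cinner x (E S x))))"

text \<open>The integral of \<open>f\<close> against the complex measure \<open>E\<^bsub>x,y\<^esub>\<close>. It is expressed through the
  polarization identity \<open>E\<^bsub>x,y\<^esub> = (\<Sum>k<4. \<i> ^ k * E\<^bsub>w k,w k\<^esub>) / 4\<close> with
  \<open>w k = y + \<i> ^ k *\<^sub>C x\<close>, the four measures on the right being positive and finite.\<close>

definition spectral_form ::
    "(complex set \<Rightarrow> 'a::complex_hilbert_space \<Rightarrow> 'a) \<Rightarrow> (complex \<Rightarrow> complex) \<Rightarrow> 'a \<Rightarrow> 'a \<Rightarrow> complex"
  where
  "spectral_form E f x y =
     (\<Sum>k<4. \<i> ^ k * (LINT z|spectral_measure E (y + \<i> ^ k *\<^sub>C x). f z)) / 4"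

definition spectral_domain ::
    "(complex set \<Rightarrow> 'a::complex_hilbert_space \<Rightarrow> 'a) \<Rightarrow> (complex \<Rightarrow> complex) \<Rightarrow> 'a set" where
  "spectral_domain E f = {x. (\<integral>\<^sup>+ z. ennreal ((cmod (f z))\<^sup>2) \<partial>spectral_measure E x) < \<infinity>}"

text \<open>The operator \<open>\<integral> f dE\<close> for Borel functions \<open>f\<close>. The test vectors \<open>y\<close> range over the
  domain, a dense subspace, because for unbounded \<open>f\<close> and arbitrary \<open>y\<close> the four integrals of
  \<open>spectral_form\<close> need not converge separately; for bounded \<open>f\<close> the domain is the whole space.\<close>

definition spectral_integral ::
    "(complex set \<Rightarrow> 'a::complex_hilbert_space \<Rightarrow> 'a) \<Rightarrow> (complex \<Rightarrow> complex) \<Rightarrow> ('a \<rightharpoonup> 'a)"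
  where
  "spectral_integral E f =
     (\<lambda>x. if x \<in> spectral_domain E f
          then Some (THE u. \<forall>y \<in> spectral_domain E f. cinner y u = spectral_form E f y x)
          else None)"

text \<open>\<open>E\<close> is the (unique, by the spectral theorem) resolution of the identity of the normal
  operator \<open>N\<close>. As a measure on all of \<open>\<complex>\<close> it vanishes off the spectrum of \<open>N\<close>.\<close>

definition resolution_of_identity ::
    "(complex set \<Rightarrow> 'a::complex_hilbert_space \<Rightarrow> 'a) \<Rightarrow> ('a \<rightharpoonup> 'a) \<Rightarrow> bool" where
  "resolution_of_identity E N \<longleftrightarrow>
     projection_valued_measure E \<and> N = spectral_integral E (\<lambda>z. z)"

definition exp_semigroup ::
    "(complex set \<Rightarrow> 'a::complex_hilbert_space \<Rightarrow> 'a) \<Rightarrow> ('a \<rightharpoonup> 'a) \<Rightarrow> real \<Rightarrow> 'a \<Rightarrow> 'a" where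
  "exp_semigroup E N t x =
     the (spectral_integral E
            (\<lambda>z. indicator (op_spectrum N) z * exp (complex_of_real t * z)) x)"

definition stable_semigroup :: "(real \<Rightarrow> 'a::real_normed_vector \<Rightarrow> 'a) \<Rightarrow> bool" where
  "stable_semigroup T \<longleftrightarrow> (\<forall>x. ((\<lambda>t. norm (T t x)) \<longlongrightarrow> 0) at_top)"

definition decay_set ::
    "(real \<Rightarrow> 'a::real_normed_vector \<Rightarrow> 'a) \<Rightarrow> (real \<Rightarrow> real) \<Rightarrow> (real \<Rightarrow> real) \<Rightarrow> 'a set" where
  "decay_set T \<alpha> \<beta> =
     {x. Limsup at_top (\<lambda>t. ereal (\<alpha> t * norm (T t x))) = \<infinity> \<and>
         Liminf at_top (\<lambda>t. ereal (\<beta> t * norm (T t x))) = 0}"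

end

theory Submission
  imports Defs
begin

text \<open>The bounded Borel functional calculus of the resolution of the identity satisfies
  \<open>norm (\<Phi> f x) ^ 2 = (LINT z|\<mu> x. cmod (f z) ^ 2)\<close>. Hence \<open>norm (T t x)\<close> is bounded below by
  \<open>exp (- t * \<delta>)\<close> times the norm of the part of \<open>x\<close> in the half plane \<open>Re z > - \<delta>\<close>, and bounded above
  by \<open>exp (- t * \<delta>) * norm x\<close> on the spectral subspace of \<open>Re z \<le> - \<delta>\<close>. Since the spectrum
  accumulates at the imaginary axis, \<open>T t\<close> has norm at least \<open>exp (- 1)\<close> for every \<open>t\<close>, so large
  values of \<open>\<alpha> t * norm (T t x)\<close> occur on open dense sets; stability makes the union of the subspaces
  \<open>Re z \<le> - 1 / n\<close> dense, so small values of \<open>\<beta> t * norm (T t x)\<close> do too, and Baire's theorem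
  applies. If \<open>\<gamma>\<close> grows exponentially, the lower bound confines the decay set to a proper closed
  subspace.\<close>

section \<open>Complex Hilbert spaces\<close>

text \<open>Two obstacles shape the proof. The integrals are defined weakly, by polarization and
  definite descriptions, so their properties have to be recovered from the projections: bounded
  functions are reached from indicators through uniform limits, and the unbounded \<open>N\<close>
  through the spectral subspaces of bounded sets, where it acts as a bounded operator. Moreover, the
  spectral bound speaks of the spectrum, which is defined by resolvents, whereas the estimates need
  \<open>E\<close>. The bridge is that the resolvent set is the largest open set on which
  \<open>E\<close> vanishes: hence \<open>E\<close> lives on the spectrum, and every half plane
  \<open>Re z > - \<delta>\<close> with \<open>\<delta> > 0\<close> carries a nonzero projection.
  The constant \<open>exp (- 1)\<close> comes from choosing \<open>\<delta>\<close> of order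
  \<open>1 / t\<close>. Stability enters the density argument by excluding mass on the imaginary
  axis, where orbits would keep their norm.\<close>

lemma cinner_zero_right [simp]: "cinner (x::'a::complex_hilbert_space) 0 = 0"
  using cinner_add_right[of x 0 0] by simp

lemma cinner_minus_right [simp]: "cinner (x::'a::complex_hilbert_space) (- y) = - cinner x y"
  using cinner_add_right[of x y "- y"] by (simp add: eq_neg_iff_add_eq_0 add.commute)

lemma cinner_diff_right: "cinner (x::'a::complex_hilbert_space) (y - z) = cinner x y - cinner x z"
  using cinner_add_right[of x y "- z"] by simp

lemma cinner_add_left: "cinner ((x::'a::complex_hilbert_space) + y) z = cinner x z + cinner y z"
  by (metis cinner_commute cinner_add_right complex_cnj_add)

lemma cinner_scaleC_left: "cinner (a *\<^sub>C (x::'a::complex_hilbert_space)) y = cnj a * cinner x y"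
  by (metis cinner_commute cinner_scaleC_right complex_cnj_mult)

lemma scaleC_zero_right [simp]: "a *\<^sub>C (0::'a::complex_hilbert_space) = 0"
  using scaleC_add_right[of a "0::'a" 0] by simp

lemma scaleC_zero_left [simp]: "0 *\<^sub>C (x::'a::complex_hilbert_space) = 0"
  using scaleC_add_left[of 0 0 x] by simp

lemma scaleC_minus_one: "(- 1) *\<^sub>C (x::'a::complex_hilbert_space) = - x"
  using scaleC_add_left[of "- 1" 1 x] by (simp add: scaleC_one eq_neg_iff_add_eq_0)

lemma scaleC_minus_left [simp]: "(- a) *\<^sub>C (x::'a::complex_hilbert_space) = - (a *\<^sub>C x)"
  using scaleC_add_left[of "- a" a x] by (simp add: eq_neg_iff_add_eq_0)

lemma scaleC_diff_right: "a *\<^sub>C ((x::'a::complex_hilbert_space) - y) = a *\<^sub>C x - a *\<^sub>C y"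
  by (metis scaleC_add_right add_diff_cancel_right' diff_add_cancel)

lemma norm_scaleC [simp]: "norm (a *\<^sub>C (x::'a::complex_hilbert_space)) = cmod a * norm x"
proof -
  have "complex_of_real ((norm (a *\<^sub>C x))\<^sup>2) = cnj a * a * complex_of_real ((norm x)\<^sup>2)"
    by (simp only: cinner_norm[symmetric] cinner_scaleC_left cinner_scaleC_right mult.assoc)
      (simp add: mult.left_commute)
  also have "\<dots> = complex_of_real ((cmod a * norm x)\<^sup>2)"
    by (metis complex_norm_square mult.commute of_real_mult power_mult_distrib)
  finally have "(norm (a *\<^sub>C x))\<^sup>2 = (cmod a * norm x)\<^sup>2"
    using of_real_eq_iff by blast
  then show ?thesis
    by simp
qed

lemma bounded_linear_scaleC: "bounded_linear (\<lambda>x::'a::complex_hilbert_space. a *\<^sub>C x)"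
  by (rule bounded_linear_intro[where K = "cmod a"])
    (simp_all add: scaleC_add_right scaleR_scaleC scaleC_scaleC mult.commute)

lemma norm_add_square:
  "(norm ((x::'a::complex_hilbert_space) + y))\<^sup>2 = (norm x)\<^sup>2 + (norm y)\<^sup>2 + 2 * Re (cinner y x)"
proof -
  have "cinner (x + y) (x + y) = cinner x x + cinner y y + (cinner y x + cnj (cinner y x))"
    by (simp add: cinner_add_right cinner_add_left cinner_commute[of x y])
  also have "\<dots> = complex_of_real ((norm x)\<^sup>2 + (norm y)\<^sup>2 + 2 * Re (cinner y x))"
    by (simp add: cinner_norm complex_add_cnj)
  finally show ?thesis
    by (metis cinner_norm of_real_eq_iff)
qed

text \<open>Weighted by \<open>\<i> ^ k\<close>, the squared norms of \<open>x\<close> and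
  \<open>y\<close> cancel and the cross terms add up to \<open>4 * cinner y x\<close>. The weights
  are not conjugated because the first slot of \<open>cinner\<close> is conjugate-linear.\<close>

lemma polarization:
  "(\<Sum>k<4. \<i> ^ k * complex_of_real ((norm (x + \<i> ^ k *\<^sub>C y))\<^sup>2)) / 4
    = cinner (y::'a::complex_hilbert_space) x"
proof -
  have sum4: "(\<Sum>k<4. f k) = f 0 + f 1 + f 2 + f 3" for f :: "nat \<Rightarrow> complex"
    by (simp add: eval_nat_numeral)
  have norm_minus: "(norm (x - u))\<^sup>2 = (norm x)\<^sup>2 + (norm u)\<^sup>2 - 2 * Re (cinner u x)" for u
    using norm_add_square[of x "- u"] by (metis (no_types) add_uminus_conv_diff cinner_minus_right
        cinner_commute complex_cnj_minus norm_minus_cancel uminus_complex.sel(1) mult_minus_right)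
  show ?thesis
    by (simp add: sum4 power3_eq_cube norm_add_square norm_minus cinner_scaleC_left
        complex_eq_iff scaleC_one)
qed

text \<open>Polarization writes the inner product as a polynomial in norms, so continuity follows
  from that of the norm, without the Cauchy-Schwarz inequality.\<close>

lemma tendsto_cinner:
  fixes u :: "'b \<Rightarrow> 'a::complex_hilbert_space"
  assumes "(u \<longlongrightarrow> l) F"
  shows "((\<lambda>i. cinner y (u i)) \<longlongrightarrow> cinner y l) F"
  unfolding polarization[symmetric] by (intro tendsto_intros assms) simp

lemma cinner_eqI:
  assumes "\<And>y. cinner y u = cinner y (v::'a::complex_hilbert_space)"
  shows "u = v"
  using assms[of "u - v"] cinner_norm[of "u - v"] by (simp add: cinner_diff_right)

section \<open>Induction on bounded Borel functions\<close>

text \<open>The bound is kept strictly positive so that later estimates can divide by it.\<close>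

definition bounded_borel :: "('b::topological_space \<Rightarrow> complex) \<Rightarrow> bool" where
  "bounded_borel f \<longleftrightarrow> f \<in> borel_measurable borel \<and> (\<exists>M>0. \<forall>z. cmod (f z) \<le> M)"

lemma bounded_borelI:
  assumes "f \<in> borel_measurable borel" "\<And>z. cmod (f z) \<le> M"
  shows "bounded_borel f"
  unfolding bounded_borel_def
  using assms by (auto intro!: exI[of _ "max M 1"] simp: le_max_iff_disj)

lemma bounded_borel_measurable [measurable_dest]: "bounded_borel f \<Longrightarrow> f \<in> borel_measurable borel"
  by (simp add: bounded_borel_def)

lemma bounded_borelE:
  assumes "bounded_borel f"
  obtains M where "M > 0" "\<And>z. cmod (f z) \<le> M"
  using assms by (auto simp: bounded_borel_def)

lemma bounded_borel_const [intro]: "bounded_borel (\<lambda>z. c)"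
  by (rule bounded_borelI[where M = "cmod c"]) auto

lemma bounded_borel_indicator [intro]: "S \<in> sets borel \<Longrightarrow> bounded_borel (indicator S)"
  by (rule bounded_borelI[where M = 1]) (auto simp: indicator_def)

lemma bounded_borel_add [intro]:
  assumes "bounded_borel f" "bounded_borel g"
  shows "bounded_borel (\<lambda>z. f z + g z)"
proof -
  obtain M M' where "\<And>z. cmod (f z) \<le> M" "\<And>z. cmod (g z) \<le> M'"
    using assms by (metis bounded_borelE)
  then show ?thesis
    using assms by (intro bounded_borelI[where M = "M + M'"] norm_triangle_mono)
      (auto simp: bounded_borel_def)
qed

lemma bounded_borel_mult [intro]:
  assumes "bounded_borel f" "bounded_borel g"
  shows "bounded_borel (\<lambda>z. f z * g z)"
proof -
  obtain M M' where "\<And>z. cmod (f z) \<le> M" "\<And>z. cmod (g z) \<le> M'" "M > 0"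
    using assms by (metis bounded_borelE)
  then show ?thesis
    using assms by (intro bounded_borelI[where M = "M * M'"])
      (auto simp: bounded_borel_def norm_mult intro!: mult_mono)
qed

lemma bounded_borel_diff [intro]:
  assumes "bounded_borel f" "bounded_borel g"
  shows "bounded_borel (\<lambda>z. f z - g z)"
  using bounded_borel_add[OF assms(1) bounded_borel_mult[OF bounded_borel_const[of "- 1"] assms(2)]]
  by simp

lemma bounded_borel_cnj [intro]:
  assumes "bounded_borel f"
  shows "bounded_borel (\<lambda>z. cnj (f z))"
  using assms unfolding bounded_borel_def
  by (auto intro: measurable_compose[OF _ borel_measurable_continuous_onI] continuous_intros)

text \<open>Limits are uniform, not pointwise, because the operator estimates to which the rule is
  applied are controlled by the supremum of the function.\<close>

lemma bounded_borel_induct [consumes 1, case_names indicator add mult lim]: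
  assumes f: "bounded_borel f"
    and indicator: "\<And>S. S \<in> sets borel \<Longrightarrow> P (indicator S)"
    and add: "\<And>f g. bounded_borel f \<Longrightarrow> bounded_borel g \<Longrightarrow> P f \<Longrightarrow> P g \<Longrightarrow> P (\<lambda>z. f z + g z)"
    and mult: "\<And>f c. bounded_borel f \<Longrightarrow> P f \<Longrightarrow> P (\<lambda>z. c * f z)"
    and lim: "\<And>f s. bounded_borel f \<Longrightarrow> (\<And>i::nat. bounded_borel (s i)) \<Longrightarrow> (\<And>i. P (s i)) \<Longrightarrow>
      uniform_limit UNIV s f sequentially \<Longrightarrow> P f"
  shows "P f"
proof -
  have fin: "P g" if g: "bounded_borel g" "finite (range g)" for g
  proof -
    have *: "P (\<lambda>z. \<Sum>c\<in>C. c * indicator (g -` {c}) z) \<and>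
        bounded_borel (\<lambda>z. \<Sum>c\<in>C. c * indicator (g -` {c}) z)" if "finite C" for C
      using that
    proof induction
      case empty
      show ?case
        using mult[OF bounded_borel_indicator[of "{}"] indicator[of "{}"], of 0]
        by (simp add: bounded_borel_const)
    next
      case (insert c C)
      have "g -` {c} \<in> sets borel"
        using measurable_sets[OF bounded_borel_measurable[OF g(1)], of "{c}"] by simp
      then have "P (\<lambda>z. c * indicator (g -` {c}) z)" "bounded_borel (\<lambda>z. c * indicator (g -` {c}) z)"
        using mult[OF bounded_borel_indicator indicator]
          bounded_borel_mult[OF bounded_borel_const bounded_borel_indicator] by blast+
      with insert.IH show ?case
        unfolding sum.insert[OF insert.hyps] using add[rotated 2] bounded_borel_add by blast
    qed
    have "(\<lambda>z. \<Sum>c\<in>range g. c * indicator (g -` {c}) z) = g"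
      using g(2) by (auto simp: indicator_def if_distrib cong: if_cong)
    with *[OF g(2)] show ?thesis
      by simp
  qed
  obtain M where M: "M > 0" "\<And>z. cmod (f z) \<le> M"
    using f by (metis bounded_borelE)
  have [measurable]: "f \<in> borel_measurable borel"
    using f by (rule bounded_borel_measurable)
  \<comment> \<open>Rounding down to the grid of mesh \<open>1 / Suc n\<close> moves real and
    imaginary part by at most the mesh and leaves a bounded function only finitely many
    values.\<close>
  define r :: "nat \<Rightarrow> real \<Rightarrow> real" where "r n a = of_int \<lfloor>real (Suc n) * a\<rfloor> / real (Suc n)" for n a
  define s where "s n z = Complex (r n (Re (f z))) (r n (Im (f z)))" for n z
  have r: "\<bar>r n a - a\<bar> \<le> 1 / real (Suc n)" for n a
  proof -
    have "r n a - a = (of_int \<lfloor>real (Suc n) * a\<rfloor> - real (Suc n) * a) / real (Suc n)"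
      by (simp add: r_def field_simps del: of_nat_Suc)
    moreover have "\<bar>of_int \<lfloor>real (Suc n) * a\<rfloor> - real (Suc n) * a\<bar> \<le> 1"
      by linarith
    ultimately show ?thesis
      by (simp only: abs_divide abs_of_nat divide_right_mono of_nat_0_le_iff)
  qed
  have dist: "cmod (s n z - f z) \<le> 2 / real (Suc n)" for n z
  proof -
    have "cmod (s n z - f z) \<le> \<bar>r n (Re (f z)) - Re (f z)\<bar> + \<bar>r n (Im (f z)) - Im (f z)\<bar>"
      using cmod_le[of "s n z - f z"] by (simp add: s_def)
    then show ?thesis
      using r[of n "Re (f z)"] r[of n "Im (f z)"] by linarith
  qed
  have s: "bounded_borel (s n)" for n
  proof (rule bounded_borelI)
    have "s n = (\<lambda>z. complex_of_real (r n (Re (f z))) + \<i> * complex_of_real (r n (Im (f z))))"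
      by (auto simp: s_def complex_eq_iff)
    then show "s n \<in> borel_measurable borel"
      unfolding r_def by simp
    show "cmod (s n z) \<le> M + 2 / real (Suc n)" for z
      using norm_triangle_sub[of "s n z" "f z"] dist[of n z] M(2)[of z] by linarith
  qed
  have "finite (range (s n))" for n
  proof -
    let ?K = "{\<lfloor>- real (Suc n) * M\<rfloor>..\<lfloor>real (Suc n) * M\<rfloor>}"
    have "\<lfloor>real (Suc n) * a\<rfloor> \<in> ?K" if "\<bar>a\<bar> \<le> M" for a
      using that mult_left_mono[of a M "real (Suc n)"] mult_left_mono[of "- M" a "real (Suc n)"]
      by (auto intro!: floor_mono simp del: of_nat_Suc)
    moreover have "\<bar>Re (f z)\<bar> \<le> M" "\<bar>Im (f z)\<bar> \<le> M" for z
      using M(2)[of z] abs_Re_le_cmod[of "f z"] abs_Im_le_cmod[of "f z"] by linarith+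
    ultimately have K: "(\<lfloor>real (Suc n) * Re (f z)\<rfloor>, \<lfloor>real (Suc n) * Im (f z)\<rfloor>) \<in> ?K \<times> ?K" for z
      by blast
    let ?h = "\<lambda>(p, q). Complex (of_int p / real (Suc n)) (of_int q / real (Suc n))"
    have "s n z \<in> ?h ` (?K \<times> ?K)" for z
      using imageI[OF K[of z], of ?h] by (simp only: s_def r_def case_prod_conv)
    then have "range (s n) \<subseteq> ?h ` (?K \<times> ?K)"
      by blast
    then show ?thesis
      by (rule finite_subset) auto
  qed
  then have P: "P (s n)" for n
    using s fin by blast
  have "uniform_limit UNIV s f sequentially"
  proof (rule uniform_limitI)
    fix e :: real assume "e > 0"
    moreover have "(\<lambda>n. 2 * inverse (real (Suc n))) \<longlonglongrightarrow> 2 * 0"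
      by (intro tendsto_intros LIMSEQ_inverse_real_of_nat)
    ultimately have "\<forall>\<^sub>F n in sequentially. 2 * inverse (real (Suc n)) < e"
      by (intro order_tendstoD) auto
    then show "\<forall>\<^sub>F n in sequentially. \<forall>z\<in>UNIV. dist (s n z) (f z) < e"
      by eventually_elim (use dist in \<open>auto simp: dist_norm divide_inverse intro: le_less_trans\<close>)
  qed
  then show ?thesis
    by (rule lim[where s = s, OF f s P])
qed

section \<open>The bounded Borel functional calculus\<close>

locale pvm =
  fixes E :: "complex set \<Rightarrow> 'a::complex_hilbert_space \<Rightarrow> 'a"
  assumes pvm: "projection_valued_measure E"
begin

abbreviation \<mu> :: "'a \<Rightarrow> complex measure" where
  "\<mu> \<equiv> spectral_measure E"

context
  fixes S :: "complex set"
  assumes S: "S \<in> sets borel"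
begin

lemma E_projection: "orthogonal_projection (E S)"
  using pvm S by (simp add: projection_valued_measure_def)

lemma E_bounded_linear: "bounded_linear (E S)"
  using E_projection by (simp add: orthogonal_projection_def)

lemma E_add: "E S (x + y) = E S x + E S y"
  by (rule bounded_linear.axioms(1)[OF E_bounded_linear, THEN linear_add])

lemma E_diff: "E S (x - y) = E S x - E S y"
  by (rule bounded_linear.axioms(1)[OF E_bounded_linear, THEN linear_diff])

lemma E_scaleC: "E S (a *\<^sub>C x) = a *\<^sub>C E S x"
  using E_projection by (simp add: orthogonal_projection_def)

lemma E_idem: "E S (E S x) = E S x"
  using E_projection by (simp add: orthogonal_projection_def)

lemma E_selfadjoint: "cinner (E S x) y = cinner x (E S y)"
  using E_projection by (simp add: orthogonal_projection_def)

lemma E_Int: "T \<in> sets borel \<Longrightarrow> E (S \<inter> T) x = E S (E T x)"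
  using pvm S by (simp add: projection_valued_measure_def)

lemma cinner_E: "cinner x (E S x) = complex_of_real ((norm (E S x))\<^sup>2)"
  by (metis E_idem E_selfadjoint cinner_norm)

end

lemma E_empty [simp]: "E {} x = 0"
  using pvm by (simp add: projection_valued_measure_def)

lemma E_UNIV [simp]: "E UNIV x = x"
  using pvm by (simp add: projection_valued_measure_def)

section \<open>The positive measures of vectors and norm convergence of the projections\<close>

lemma sets_mu [simp, measurable_cong]: "sets (\<mu> x) = sets borel"
  unfolding spectral_measure_def by (simp add: sets.sigma_sets_eq[of borel, simplified])

lemma space_mu [simp]: "space (\<mu> x) = UNIV"
  unfolding spectral_measure_def by simp

text \<open>\<open>measure_of\<close> takes the prescribed values only after positivity and
  countable additivity are shown. The numbers \<open>cinner x (E T x)\<close> are squared norms, so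
  \<open>ennreal\<close> truncates nothing.\<close>

lemma emeasure_mu:
  assumes "S \<in> sets borel"
  shows "emeasure (\<mu> x) S = ennreal ((norm (E S x))\<^sup>2)"
proof -
  have nonneg: "Re (cinner x (E T x)) \<ge> 0" if "T \<in> sets borel" for T
    using that by (simp add: cinner_E)
  have "emeasure (\<mu> x) S = ennreal (Re (cinner x (E S x)))"
    unfolding spectral_measure_def
  proof (rule emeasure_measure_of_sigma)
    show "sigma_algebra UNIV (sets (borel :: complex measure))"
      using sets.sigma_algebra_axioms[of "borel :: complex measure"] by simp
    show "positive (sets borel) (\<lambda>S. ennreal (Re (cinner x (E S x))))"
      by (simp add: positive_def)
    show "countably_additive (sets borel) (\<lambda>S. ennreal (Re (cinner x (E S x))))"
    proof (rule countably_additiveI)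
      fix A :: "nat \<Rightarrow> complex set"
      assume A: "range A \<subseteq> sets borel" "disjoint_family A"
      then have "(\<lambda>n. cinner x (E (A n) x)) sums cinner x (E (\<Union>n. A n) x)"
        using pvm by (simp add: projection_valued_measure_def)
      then show "(\<Sum>n. ennreal (Re (cinner x (E (A n) x)))) = ennreal (Re (cinner x (E (\<Union>n. A n) x)))"
        using A by (intro suminf_ennreal_eq sums_Re nonneg) auto
    qed
  qed (use assms in auto)
  then show ?thesis
    using assms by (simp add: cinner_E)
qed

lemma finite_measure_mu: "finite_measure (\<mu> x)"
  by (rule finite_measureI) (simp add: emeasure_mu)

lemma measure_mu: "S \<in> sets borel \<Longrightarrow> measure (\<mu> x) S = (norm (E S x))\<^sup>2"
  by (simp add: measure_def emeasure_mu)

lemma E_compl: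
  assumes "S \<in> sets borel"
  shows "E S x + E (- S) x = x"
proof -
  have "(norm (E S x))\<^sup>2 + (norm (E (- S) x))\<^sup>2 = (norm x)\<^sup>2" for x
    using finite_measure.finite_measure_Union[OF finite_measure_mu[of x], of S "- S"] assms
    by (simp add: measure_mu)
  \<comment> \<open>Pythagoras is applied to the defect itself, which both projections
    annihilate.\<close>
  from this[of "x - E S x - E (- S) x"]
  have "norm (x - E S x - E (- S) x) = 0"
    using assms E_Int[of S "- S"] E_Int[of "- S" S] by (simp add: E_diff E_idem)
  then show ?thesis
    by (simp add: algebra_simps)
qed

lemma E_disjoint:
  assumes "S \<in> sets borel" "T \<in> sets borel" "S \<inter> T = {}"
  shows "E S (E T x) = 0"
  using assms E_Int[of S T x] by simp

text \<open>Countable additivity of \<open>E\<close> is assumed only weakly. Convergence in norm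
  comes from continuity from above of the finite measure \<open>\<mu> x\<close>, whose values are
  \<open>(norm (E S x))\<^sup>2\<close>.\<close>

lemma E_decseq:
  assumes "range A \<subseteq> sets borel" "decseq A" "(\<Inter>n. A n) = {}"
  shows "(\<lambda>n. E (A n) x) \<longlonglongrightarrow> 0"
proof -
  have "(\<lambda>n. measure (\<mu> x) (A n)) \<longlonglongrightarrow> measure (\<mu> x) (\<Inter>n. A n)"
    using assms by (intro finite_measure.finite_Lim_measure_decseq finite_measure_mu) auto
  then have "(\<lambda>n. sqrt ((norm (E (A n) x))\<^sup>2)) \<longlonglongrightarrow> sqrt 0"
    using assms by (intro tendsto_real_sqrt) (auto simp: measure_mu range_subsetD)
  then show ?thesis
    by (simp add: tendsto_norm_zero_iff)
qed

lemma E_incseq: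
  assumes "range A \<subseteq> sets borel" "incseq A" "(\<Union>n. A n) = UNIV"
  shows "(\<lambda>n. E (A n) x) \<longlonglongrightarrow> x"
proof -
  have "(\<lambda>n. E (- A n) x) \<longlonglongrightarrow> 0"
    using assms by (intro E_decseq) (auto simp: decseq_def incseq_def)
  then have "(\<lambda>n. x - E (- A n) x) \<longlonglongrightarrow> x - 0"
    by (intro tendsto_intros)
  moreover have "x - E (- A n) x = E (A n) x" for n
    using E_compl[of "A n" x] assms(1) by (auto simp: algebra_simps)
  ultimately show ?thesis
    by simp
qed

lemma mu_scaleC:
  assumes "cmod c = 1"
  shows "\<mu> (c *\<^sub>C x) = \<mu> x"
  by (rule measure_eqI) (simp_all add: emeasure_mu E_scaleC assms)

text \<open>Lets an indicator in an integrand be moved onto the vector as a projection;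
  multiplicativity of the calculus rests on this.\<close>

lemma density_mu:
  assumes S: "S \<in> sets borel"
  shows "density (\<mu> x) (indicator S) = \<mu> (E S x)"
proof (rule measure_eqI)
  fix T assume "T \<in> sets (density (\<mu> x) (indicator S))"
  then have T: "T \<in> sets borel"
    by simp
  then have "emeasure (density (\<mu> x) (indicator S)) T = emeasure (\<mu> x) (T \<inter> S)"
    using S by (subst emeasure_density)
      (simp_all flip: indicator_inter_arith nn_integral_indicator add: Int_commute mult.commute)
  then show "emeasure (density (\<mu> x) (indicator S)) T = emeasure (\<mu> (E S x)) T"
    using S T by (simp add: emeasure_mu E_Int)
qed simp

lemma integral_indicator_mu:
  fixes f :: "complex \<Rightarrow> complex"
  assumes [measurable]: "S \<in> sets borel" "f \<in> borel_measurable borel"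
  shows "(LINT z|\<mu> x. indicator S z * f z) = (LINT z|\<mu> (E S x). f z)"
proof -
  have "(LINT z|\<mu> (E S x). f z) = (LINT z|density (\<mu> x) (\<lambda>z. ennreal (indicator S z)). f z)"
    by (simp add: density_mu ennreal_indicator)
  also have "\<dots> = (LINT z|\<mu> x. (indicator S z :: real) *\<^sub>R f z)"
    by (rule integral_density) auto
  also have "\<dots> = (LINT z|\<mu> x. indicator S z * f z)"
    by (rule Bochner_Integration.integral_cong) (auto simp: indicator_def)
  finally show ?thesis
    by simp
qed

lemma integrable_bounded_borel:
  assumes "bounded_borel f"
  shows "integrable (\<mu> x) f"
proof -
  obtain M where "\<And>z. cmod (f z) \<le> M"
    using assms by (metis bounded_borelE)
  moreover have "f \<in> borel_measurable borel"
    using assms by (rule bounded_borel_measurable)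
  ultimately show ?thesis
    by (intro finite_measure.integrable_const_bound[OF finite_measure_mu, where B = M]) auto
qed

lemma integral_bound:
  assumes "bounded_borel f" "\<And>z. cmod (f z) \<le> M"
  shows "cmod (LINT z|\<mu> x. f z) \<le> M * (norm x)\<^sup>2"
proof -
  have "cmod (LINT z|\<mu> x. f z) \<le> (LINT z|\<mu> x. cmod (f z))"
    by (rule integral_norm_bound)
  also have "\<dots> \<le> (LINT z|\<mu> x. M)"
    using assms integrable_bounded_borel[OF assms(1)] finite_measure.integrable_const[OF finite_measure_mu]
    by (intro integral_mono) auto
  also have "\<dots> = M * (norm x)\<^sup>2"
    by (simp add: measure_mu)
  finally show ?thesis .
qed

section \<open>The polarized form of a bounded function\<close>

lemma spectral_form_indicator:
  assumes S: "S \<in> sets borel"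
  shows "spectral_form E (indicator S) y x = cinner y (E S x)"
proof -
  have "(LINT z|\<mu> w. indicator S z) = complex_of_real ((norm (E S w))\<^sup>2)" for w
  proof -
    have "(LINT z|\<mu> w. (indicator S z :: complex)) = (LINT z|\<mu> (E S w). 1)"
      using integral_indicator_mu[OF S, of "\<lambda>z. 1" w] by simp
    then show ?thesis
      by (simp add: measure_mu scaleR_conv_of_real)
  qed
  then have "spectral_form E (indicator S) y x =
      (\<Sum>k<4. \<i> ^ k * complex_of_real ((norm (E S x + \<i> ^ k *\<^sub>C E S y))\<^sup>2)) / 4"
    using S by (simp add: spectral_form_def E_add E_scaleC)
  also have "\<dots> = cinner (E S y) (E S x)"
    by (rule polarization)
  finally show ?thesis
    using S by (simp add: E_selfadjoint E_idem)
qed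

lemma spectral_form_add:
  assumes "bounded_borel f" "bounded_borel g"
  shows "spectral_form E (\<lambda>z. f z + g z) y x = spectral_form E f y x + spectral_form E g y x"
  by (simp add: spectral_form_def integrable_bounded_borel assms distrib_left sum.distrib
      add_divide_distrib)

lemma spectral_form_mult: "spectral_form E (\<lambda>z. c * f z) y x = c * spectral_form E f y x"
  by (simp add: spectral_form_def sum_distrib_left mult_ac)

text \<open>The squared norms of the four polarization vectors add up to
  \<open>4 * ((norm x)\<^sup>2 + (norm y)\<^sup>2)\<close>, their cross terms cancelling. This
  yields a quadratic bound and not yet one by \<open>norm x * norm y\<close>.\<close>

lemma spectral_form_bound:
  assumes "bounded_borel f" "\<And>z. cmod (f z) \<le> M"
  shows "cmod (spectral_form E f y x) \<le> M * ((norm x)\<^sup>2 + (norm y)\<^sup>2)"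
proof -
  have sum4: "(\<Sum>k<4. f k) = f 0 + f 1 + f 2 + f 3" for f :: "nat \<Rightarrow> real"
    by (simp add: eval_nat_numeral)
  have "cmod (\<Sum>k<4. \<i> ^ k * (LINT z|\<mu> (x + \<i> ^ k *\<^sub>C y). f z)) \<le>
      (\<Sum>k<4. cmod (\<i> ^ k * (LINT z|\<mu> (x + \<i> ^ k *\<^sub>C y). f z)))"
    by (rule norm_sum)
  also have "\<dots> \<le> (\<Sum>k<4. M * (norm (x + \<i> ^ k *\<^sub>C y))\<^sup>2)"
    by (intro sum_mono) (simp add: norm_mult norm_power integral_bound assms)
  also have "\<dots> = 4 * (M * ((norm x)\<^sup>2 + (norm y)\<^sup>2))"
    by (simp add: norm_add_square sum4 power3_eq_cube cinner_scaleC_left algebra_simps)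
  finally show ?thesis
    by (simp add: spectral_form_def norm_divide)
qed

text \<open>Test the form against \<open>u\<close> scaled by \<open>1 / (2 * M)\<close>; the quadratic bound then becomes linear.\<close>

lemma norm_le_of_spectral_form:
  assumes f: "bounded_borel f" "\<And>z. cmod (f z) \<le> M" "M > 0"
    and u: "\<And>y. cinner y u = spectral_form E f y x"
  shows "norm u \<le> 2 * M * norm x"
proof -
  have "cmod (cinner (complex_of_real (1 / (2 * M)) *\<^sub>C u) u) \<le>
      M * ((norm x)\<^sup>2 + (norm (complex_of_real (1 / (2 * M)) *\<^sub>C u))\<^sup>2)"
    using spectral_form_bound[OF f(1,2)] by (simp only: u)
  then have "(norm u)\<^sup>2 / (2 * M) \<le> M * (norm x)\<^sup>2 + (norm u)\<^sup>2 / (4 * M)"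
    using \<open>M > 0\<close>
    by (simp add: cinner_scaleC_left cinner_norm norm_mult norm_divide field_simps power2_eq_square)
  then have "(norm u)\<^sup>2 \<le> (2 * M * norm x)\<^sup>2"
    using \<open>M > 0\<close> by (simp add: field_simps power2_eq_square)
  then show ?thesis
    by (rule power2_le_imp_le) (use \<open>M > 0\<close> in simp)
qed

lemma integral_tendsto:
  assumes f: "bounded_borel f" and s: "\<And>i::nat. bounded_borel (s i)"
    and lim: "uniform_limit UNIV s f sequentially"
  shows "(\<lambda>i. LINT z|\<mu> w. s i z) \<longlonglongrightarrow> (LINT z|\<mu> w. f z)"
proof (rule LIMSEQ_I)
  fix e :: real assume "e > 0"
  define d where "d = e / ((norm w)\<^sup>2 + 1)"
  have "(norm w)\<^sup>2 + 1 > 0"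
    by (simp add: add_nonneg_pos)
  then have "d > 0"
    using \<open>e > 0\<close> by (simp add: d_def)
  have "e * (norm w)\<^sup>2 < e * ((norm w)\<^sup>2 + 1)"
    using \<open>e > 0\<close> by simp
  then have d: "d > 0" "d * (norm w)\<^sup>2 < e"
    using \<open>d > 0\<close> \<open>(norm w)\<^sup>2 + 1 > 0\<close> by (simp_all add: d_def pos_divide_less_eq)
  obtain n where n: "\<And>i z. i \<ge> n \<Longrightarrow> cmod (s i z - f z) < d"
    using uniform_limitD[OF lim d(1)] by (auto simp: eventually_sequentially dist_norm)
  have "norm ((LINT z|\<mu> w. s i z) - (LINT z|\<mu> w. f z)) < e" if "i \<ge> n" for i
  proof -
    have "(LINT z|\<mu> w. s i z) - (LINT z|\<mu> w. f z) = (LINT z|\<mu> w. s i z - f z)"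
      using f s by (simp add: integrable_bounded_borel)
    also have "cmod \<dots> \<le> d * (norm w)\<^sup>2"
      using n[OF that] f s by (intro integral_bound bounded_borel_diff) (auto intro: less_imp_le)
    finally show ?thesis
      using d by simp
  qed
  then show "\<exists>n. \<forall>i\<ge>n. norm ((LINT z|\<mu> w. s i z) - (LINT z|\<mu> w. f z)) < e"
    by blast
qed

lemma spectral_form_tendsto:
assumes "bounded_borel f" "\<And>i::nat. bounded_borel (s i)"
  and "uniform_limit UNIV s f sequentially"
shows "(\<lambda>i. spectral_form E (s i) y x) \<longlonglongrightarrow> spectral_form E f y x"
unfolding spectral_form_def by (intro tendsto_intros integral_tendsto assms) simp

text \<open>Replaces the Riesz representation theorem: the operator is built along the induction, as
  a norm limit in the last case. Linearity is carried in the induction hypothesis because it is not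
  visible from the polarized form.\<close>

lemma calculus_exists:
  assumes "bounded_borel f"
  shows "\<exists>U. (\<forall>x y. U (x + y) = U x + U y) \<and> (\<forall>c x. U (c *\<^sub>C x) = c *\<^sub>C U x) \<and>
    (\<forall>x y. cinner y (U x) = spectral_form E f y x)"
  using assms
proof (induction rule: bounded_borel_induct)
  case (indicator S)
  then show ?case
    by (intro exI[of _ "E S"]) (simp add: E_add E_scaleC spectral_form_indicator)
next
  case (add f g)
  then obtain U V where
    "\<forall>x y. U (x + y) = U x + U y" "\<forall>c x. U (c *\<^sub>C x) = c *\<^sub>C U x"
    "\<forall>x y. cinner y (U x) = spectral_form E f y x"
    "\<forall>x y. V (x + y) = V x + V y" "\<forall>c x. V (c *\<^sub>C x) = c *\<^sub>C V x"
    "\<forall>x y. cinner y (V x) = spectral_form E g y x"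
    by blast
  then show ?case
    using add.hyps by (intro exI[of _ "\<lambda>x. U x + V x"])
      (simp add: spectral_form_add cinner_add_right scaleC_add_right)
next
  case (mult f c)
  then obtain U where
    "\<forall>x y. U (x + y) = U x + U y" "\<forall>c x. U (c *\<^sub>C x) = c *\<^sub>C U x"
    "\<forall>x y. cinner y (U x) = spectral_form E f y x"
    by blast
  then show ?case
    by (intro exI[of _ "\<lambda>x. c *\<^sub>C U x"])
      (simp add: spectral_form_mult cinner_scaleC_right scaleC_add_right scaleC_scaleC mult.commute)
next
  case (lim f s)
  then obtain U where U:
    "\<And>i x y. U i (x + y) = U i x + U i y" "\<And>i c x. U i (c *\<^sub>C x) = c *\<^sub>C U i x"
    "\<And>i x y. cinner y (U i x) = spectral_form E (s i) y x"
    by metis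
  have "convergent (\<lambda>i. U i x)" for x
  proof (rule Cauchy_convergent, rule CauchyI)
    fix e :: real assume "e > 0"
    \<comment> \<open>The 4 is the 2 of \<open>norm_le_of_spectral_form\<close> times the 2 from
      comparing two functions that are both within \<open>d\<close> of \<open>f\<close>; the
      \<open>+ 1\<close> covers \<open>x = 0\<close>.\<close>
    define d where "d = e / (4 * (norm x + 1))"
    have "norm x + 1 > 0"
      by (simp add: add_nonneg_pos)
    with \<open>e > 0\<close> have "d > 0"
      by (simp add: d_def)
    have "4 * d * norm x < 4 * d * (norm x + 1)"
      using \<open>d > 0\<close> by simp
    also have "\<dots> = e"
      using \<open>norm x + 1 > 0\<close> by (simp add: d_def field_simps)
    finally have "4 * d * norm x < e" .
    obtain n where n: "\<And>i z. i \<ge> n \<Longrightarrow> cmod (s i z - f z) < d"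
      using uniform_limitD[OF lim.hyps(3) \<open>d > 0\<close>] by (auto simp: eventually_sequentially dist_norm)
    have "norm (U i x - U j x) < e" if "i \<ge> n" "j \<ge> n" for i j
    proof -
      have "cmod (s i z - s j z) \<le> 2 * d" for z
        using norm_triangle_ineq4[of "s i z - f z" "s j z - f z"] n[OF that(1), of z] n[OF that(2), of z]
        by simp
      moreover have "cinner y (U i x - U j x) = spectral_form E (\<lambda>z. s i z - s j z) y x" for y
        using spectral_form_add[of "s i" "\<lambda>z. - 1 * s j z" y x] spectral_form_mult[of "- 1" "s j" y x]
          bounded_borel_mult[OF bounded_borel_const[of "- 1"] lim(2)[of j]] lim(2)[of i]
        by (simp add: cinner_diff_right U(3))
      ultimately have "norm (U i x - U j x) \<le> 2 * (2 * d) * norm x"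
        using \<open>d > 0\<close> lim(2)
        by (intro norm_le_of_spectral_form[where f = "\<lambda>z. s i z - s j z"] bounded_borel_diff) auto
      with \<open>4 * d * norm x < e\<close> show ?thesis
        by simp
    qed
    then show "\<exists>n. \<forall>i\<ge>n. \<forall>j\<ge>n. norm (U i x - U j x) < e"
      by blast
  qed
  then obtain V where V: "\<And>x. (\<lambda>i. U i x) \<longlonglongrightarrow> V x"
    unfolding convergent_def by metis
  show ?case
  proof (intro exI[of _ V] conjI allI)
    fix x y :: 'a and c :: complex
    show "V (x + y) = V x + V y"
      using LIMSEQ_unique[OF V[of "x + y"]] tendsto_add[OF V[of x] V[of y]] by (simp add: U(1))
    show "V (c *\<^sub>C x) = c *\<^sub>C V x"
      using LIMSEQ_unique[OF V[of "c *\<^sub>C x"]] bounded_linear.tendsto[OF bounded_linear_scaleC V[of x], of c]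
      by (simp add: U(2))
    show "cinner y (V x) = spectral_form E f y x"
      using LIMSEQ_unique[OF tendsto_cinner[OF V[of x], of y]] spectral_form_tendsto[OF lim.hyps]
      by (simp add: U(3))
  qed
qed

text \<open>The description inside \<open>spectral_integral\<close> in the case where the spectral
  domain is the whole space, so the semigroup unfolds to it directly.\<close>

definition \<Phi> :: "(complex \<Rightarrow> complex) \<Rightarrow> 'a \<Rightarrow> 'a" where
  "\<Phi> f x = (THE u. \<forall>y. cinner y u = spectral_form E f y x)"

lemma Phi_eqI: "(\<And>y. cinner y u = spectral_form E f y x) \<Longrightarrow> \<Phi> f x = u"
  unfolding \<Phi>_def by (rule the_equality) (auto intro: cinner_eqI)

lemma
  assumes f: "bounded_borel f"
  shows cinner_Phi: "cinner y (\<Phi> f x) = spectral_form E f y x"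
    and Phi_add_arg: "\<Phi> f (x + y) = \<Phi> f x + \<Phi> f y"
    and Phi_scaleC_arg: "\<Phi> f (c *\<^sub>C x) = c *\<^sub>C \<Phi> f x"
proof -
  obtain U where U: "\<forall>x y. U (x + y) = U x + U y" "\<forall>c x. U (c *\<^sub>C x) = c *\<^sub>C U x"
    "\<forall>x y. cinner y (U x) = spectral_form E f y x"
    using calculus_exists[OF f] by blast
  then have "\<Phi> f = U"
    by (intro ext Phi_eqI) simp
  with U show "cinner y (\<Phi> f x) = spectral_form E f y x" "\<Phi> f (x + y) = \<Phi> f x + \<Phi> f y"
    "\<Phi> f (c *\<^sub>C x) = c *\<^sub>C \<Phi> f x"
    by simp_all
qed

lemma Phi_indicator: "S \<in> sets borel \<Longrightarrow> \<Phi> (indicator S) x = E S x"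
  by (rule Phi_eqI) (simp add: spectral_form_indicator)

lemma Phi_add:
  "bounded_borel f \<Longrightarrow> bounded_borel g \<Longrightarrow> \<Phi> (\<lambda>z. f z + g z) x = \<Phi> f x + \<Phi> g x"
  by (rule Phi_eqI) (simp add: spectral_form_add cinner_add_right cinner_Phi)

lemma Phi_mult: "bounded_borel f \<Longrightarrow> \<Phi> (\<lambda>z. c * f z) x = c *\<^sub>C \<Phi> f x"
  by (rule Phi_eqI) (simp add: spectral_form_mult cinner_scaleC_right cinner_Phi)

lemma Phi_diff:
  assumes "bounded_borel f" "bounded_borel g"
  shows "\<Phi> (\<lambda>z. f z - g z) x = \<Phi> f x - \<Phi> g x"
  using Phi_add[OF assms(1) bounded_borel_mult[OF bounded_borel_const[of "- 1"] assms(2)], of x]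
    Phi_mult[OF assms(2), of "- 1" x] by (simp add: scaleC_one)

text \<open>The factor 2 is an artefact of the quadratic form bound. It suffices for continuity in
  \<open>f\<close> and \<open>x\<close>; sharp estimates follow once multiplicativity yields
  \<open>norm_Phi\<close>.\<close>

lemma norm_Phi_le_aux:
  assumes "bounded_borel f" "\<And>z. cmod (f z) \<le> M" "M > 0"
  shows "norm (\<Phi> f x) \<le> 2 * M * norm x"
  using assms by (intro norm_le_of_spectral_form[where f = f]) (auto simp: cinner_Phi)

lemma Phi_bounded_linear:
  assumes "bounded_borel f"
  shows "bounded_linear (\<Phi> f)"
proof -
  obtain M where M: "M > 0" "\<And>z. cmod (f z) \<le> M"
    using assms by (metis bounded_borelE)
  then show ?thesis
    using norm_Phi_le_aux[OF assms] assms
    by (intro bounded_linear_intro[where K = "2 * M"])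
      (auto simp: Phi_add_arg Phi_scaleC_arg scaleR_scaleC mult.commute)
qed

lemma Phi_tendsto:
  assumes f: "bounded_borel f" and s: "\<And>i::nat. bounded_borel (s i)"
    and lim: "uniform_limit UNIV s f sequentially"
  shows "(\<lambda>i. \<Phi> (s i) x) \<longlonglongrightarrow> \<Phi> f x"
proof (rule LIMSEQ_I)
  fix e :: real assume "e > 0"
  define d where "d = e / (2 * (norm x + 1))"
  have "norm x + 1 > 0"
    by (simp add: add_nonneg_pos)
  with \<open>e > 0\<close> have "d > 0"
    by (simp add: d_def)
  have "2 * d * norm x < 2 * d * (norm x + 1)"
    using \<open>d > 0\<close> by simp
  also have "\<dots> = e"
    using \<open>norm x + 1 > 0\<close> by (simp add: d_def field_simps)
  finally have "2 * d * norm x < e" .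
  moreover obtain n where n: "\<And>i z. i \<ge> n \<Longrightarrow> cmod (s i z - f z) < d"
    using uniform_limitD[OF lim \<open>d > 0\<close>] by (auto simp: eventually_sequentially dist_norm)
  ultimately have "norm (\<Phi> (s i) x - \<Phi> f x) < e" if "i \<ge> n" for i
    using norm_Phi_le_aux[of "\<lambda>z. s i z - f z" d x] n[OF that] \<open>d > 0\<close> f s
    by (force simp: Phi_diff bounded_borel_diff less_imp_le)
  then show "\<exists>n. \<forall>i\<ge>n. norm (\<Phi> (s i) x - \<Phi> f x) < e"
    by blast
qed

text \<open>Integrability is required only for the four polarization measures, so the splitting also
  covers the unbounded function \<open>z\<close> on vectors of the domain of
  \<open>N\<close>.\<close>

lemma spectral_form_split:
  assumes [measurable]: "S \<in> sets borel" "f \<in> borel_measurable borel"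
    and int: "\<And>k. integrable (\<mu> (x + \<i> ^ k *\<^sub>C y)) f"
  shows "spectral_form E f y x = spectral_form E f (E S y) (E S x) + spectral_form E f (E (- S) y) (E (- S) x)"
proof -
  have "(LINT z|\<mu> (x + \<i> ^ k *\<^sub>C y). f z) =
    (LINT z|\<mu> (E S x + \<i> ^ k *\<^sub>C E S y). f z) + (LINT z|\<mu> (E (- S) x + \<i> ^ k *\<^sub>C E (- S) y). f z)" for k
  proof -
    let ?M = "\<mu> (x + \<i> ^ k *\<^sub>C y)"
    have restr: "integrable ?M (\<lambda>z. indicator T z * f z)" if [measurable]: "T \<in> sets borel" for T
      by (rule Bochner_Integration.integrable_bound[OF int[of k]]) (auto simp: indicator_def)
    have "(LINT z|?M. f z) = (LINT z|?M. indicator S z * f z + indicator (- S) z * f z)"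
      by (rule Bochner_Integration.integral_cong) (auto simp: indicator_def)
    also have "\<dots> = (LINT z|?M. indicator S z * f z) + (LINT z|?M. indicator (- S) z * f z)"
      by (intro Bochner_Integration.integral_add restr) auto
    finally show ?thesis
      by (simp add: integral_indicator_mu E_add E_scaleC)
  qed
  then show ?thesis
    by (simp add: spectral_form_def distrib_left sum.distrib add_divide_distrib)
qed

text \<open>If one argument is zero, the four polarization vectors differ by unimodular scalars and
  have the same measure; the powers of \<open>\<i>\<close> then sum to zero. This holds for every
  \<open>f\<close>, integrable or not.\<close>

lemma spectral_form_zero [simp]:
  shows "spectral_form E f 0 x = 0" "spectral_form E f x 0 = 0"
proof -
  have sum4: "(\<Sum>k<4. \<i> ^ k * c) = 0" for c :: complex
    by (simp add: eval_nat_numeral)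
  have "\<mu> (\<i> ^ k *\<^sub>C x) = \<mu> x" for k
    by (rule mu_scaleC) (simp add: norm_power)
  then show "spectral_form E f 0 x = 0" "spectral_form E f x 0 = 0"
    by (simp_all add: spectral_form_def sum4)
qed

lemma spectral_form_indicator_times:
  assumes [measurable]: "S \<in> sets borel" "f \<in> borel_measurable borel"
  shows "spectral_form E (\<lambda>z. indicator S z * f z) y x = spectral_form E f (E S y) (E S x)"
  by (simp add: spectral_form_def integral_indicator_mu E_add E_scaleC)

text \<open>Self-adjointness moves the projection onto the test vector \<open>y\<close>; in the
  split form the complementary part then vanishes, since \<open>E (- S) (E S y) = 0\<close>.\<close>

lemma E_Phi:
  assumes S: "S \<in> sets borel" and f: "bounded_borel f"
  shows "E S (\<Phi> f x) = \<Phi> (\<lambda>z. indicator S z * f z) x"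
proof (rule Phi_eqI[symmetric])
  fix y
  have "cinner y (E S (\<Phi> f x)) = spectral_form E f (E S y) x"
    using S f by (simp flip: E_selfadjoint cinner_Phi)
  also have "\<dots> = spectral_form E f (E S y) (E S x)"
    using spectral_form_split[OF S bounded_borel_measurable[OF f] integrable_bounded_borel[OF f], of "E S y" x]
    using E_disjoint[of "- S" S y] S by (simp add: E_idem)
  finally show "cinner y (E S (\<Phi> f x)) = spectral_form E (\<lambda>z. indicator S z * f z) y x"
    using S f by (simp add: spectral_form_indicator_times bounded_borel_measurable)
qed

text \<open>The induction runs over \<open>g\<close> alone with \<open>f\<close> fixed; the
  indicator case is \<open>E_Phi\<close>, and multiplication by the bounded \<open>f\<close>
  preserves uniform limits.\<close>

lemma Phi_Phi:
  assumes "bounded_borel g" and f: "bounded_borel f"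
  shows "\<Phi> g (\<Phi> f x) = \<Phi> (\<lambda>z. g z * f z) x"
  using assms(1)
proof (induction rule: bounded_borel_induct)
  case (indicator S)
  then show ?case
    by (simp add: Phi_indicator E_Phi f)
next
  case (add g h)
  then show ?case
    by (simp add: Phi_add f distrib_right bounded_borel_mult)
next
  case (mult g c)
  then show ?case
    by (simp add: Phi_mult f mult.assoc bounded_borel_mult)
next
  case (lim g s)
  obtain M where M: "M > 0" "\<And>z. cmod (f z) \<le> M"
    using f by (metis bounded_borelE)
  have "uniform_limit UNIV (\<lambda>i z. s i z * f z) (\<lambda>z. g z * f z) sequentially"
  proof (rule uniform_limitI)
    fix e :: real assume "e > 0"
    have "cmod (a * f z - b * f z) < e" if "cmod (a - b) < e / M" for a b z
    proof -
      have "cmod (a * f z - b * f z) \<le> cmod (a - b) * M"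
        by (simp add: M(2) mult_left_mono norm_mult flip: left_diff_distrib)
      also have "\<dots> < e"
        using that M(1) by (simp add: pos_less_divide_eq)
      finally show ?thesis .
    qed
    moreover have "\<forall>\<^sub>F i in sequentially. \<forall>z\<in>UNIV. dist (s i z) (g z) < e / M"
      using uniform_limitD[OF lim.hyps(3), of "e / M"] \<open>e > 0\<close> M(1) by simp
    ultimately show "\<forall>\<^sub>F i in sequentially. \<forall>z\<in>UNIV. dist (s i z * f z) (g z * f z) < e"
      by (auto simp: dist_norm elim!: eventually_mono)
  qed
  then have "(\<lambda>i. \<Phi> (\<lambda>z. s i z * f z) x) \<longlonglongrightarrow> \<Phi> (\<lambda>z. g z * f z) x"
    using lim(1,2) f by (intro Phi_tendsto) auto
  moreover have "(\<lambda>i. \<Phi> (s i) (\<Phi> f x)) \<longlonglongrightarrow> \<Phi> g (\<Phi> f x)"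
    using lim by (intro Phi_tendsto) auto
  ultimately show ?case
    using lim.IH LIMSEQ_unique by simp
qed

section \<open>The isometry identity and the resulting two-sided norm bounds\<close>

lemma cinner_Phi_same:
  assumes "bounded_borel f"
  shows "cinner x (\<Phi> f x) = (LINT z|\<mu> x. f z)"
  using assms
proof (induction rule: bounded_borel_induct)
  case (indicator S)
  have "(LINT z|\<mu> x. (indicator S z :: complex)) = (LINT z|\<mu> (E S x). 1)"
    using integral_indicator_mu[OF indicator, of "\<lambda>z. 1" x] by simp
  then show ?case
    using indicator by (simp add: Phi_indicator cinner_E measure_mu scaleR_conv_of_real)
next
  case (add f g)
  then show ?case
    by (simp add: Phi_add cinner_add_right integrable_bounded_borel)
next
  case (mult f c)
  then show ?case
    by (simp add: Phi_mult cinner_scaleC_right)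
next
  case (lim f s)
  have "(\<lambda>i. cinner x (\<Phi> (s i) x)) \<longlonglongrightarrow> cinner x (\<Phi> f x)"
    using lim by (intro tendsto_cinner Phi_tendsto) auto
  moreover have "(\<lambda>i. LINT z|\<mu> x. s i z) \<longlonglongrightarrow> (LINT z|\<mu> x. f z)"
    using lim by (intro integral_tendsto) auto
  ultimately show ?case
    using lim.IH LIMSEQ_unique by simp
qed

lemma Phi_adjoint:
  assumes "bounded_borel f"
  shows "cinner (\<Phi> f y) x = cinner y (\<Phi> (\<lambda>z. cnj (f z)) x)"
  using assms
proof (induction rule: bounded_borel_induct)
  case (indicator S)
  moreover have "(\<lambda>z. cnj (indicator S z)) = indicator S"
    by (auto simp: indicator_def)
  ultimately show ?case
    by (simp add: Phi_indicator E_selfadjoint)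
next
  case (add f g)
  then show ?case
    by (simp add: Phi_add cinner_add_right cinner_add_left bounded_borel_cnj)
next
  case (mult f c)
  then show ?case
    by (simp add: Phi_mult cinner_scaleC_right cinner_scaleC_left bounded_borel_cnj)
next
  case (lim f s)
  have "(\<lambda>i. cnj (cinner x (\<Phi> (s i) y))) \<longlonglongrightarrow> cnj (cinner x (\<Phi> f y))"
    using lim by (intro tendsto_cnj tendsto_cinner Phi_tendsto) auto
  moreover have "uniform_limit UNIV (\<lambda>i z. cnj (s i z)) (\<lambda>z. cnj (f z)) sequentially"
    using lim.hyps(3) by (simp add: uniform_limit_iff dist_norm del: complex_cnj_diff flip: complex_cnj_diff)
  then have "(\<lambda>i. cinner y (\<Phi> (\<lambda>z. cnj (s i z)) x)) \<longlonglongrightarrow> cinner y (\<Phi> (\<lambda>z. cnj (f z)) x)"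
    using lim(1,2) by (intro tendsto_cinner Phi_tendsto) auto
  ultimately show ?case
    using lim.IH LIMSEQ_unique by (simp flip: cinner_commute)
qed

lemma norm_Phi:
  assumes f: "bounded_borel f"
  shows "(norm (\<Phi> f x))\<^sup>2 = (LINT z|\<mu> x. (cmod (f z))\<^sup>2)"
proof -
  have "complex_of_real ((norm (\<Phi> f x))\<^sup>2) = cinner (\<Phi> f x) (\<Phi> f x)"
    by (rule cinner_norm[symmetric])
  also have "\<dots> = cinner x (\<Phi> (\<lambda>z. cnj (f z) * f z) x)"
    using f by (simp add: Phi_adjoint Phi_Phi bounded_borel_cnj)
  also have "\<dots> = (LINT z|\<mu> x. cnj (f z) * f z)"
    using f by (simp add: cinner_Phi_same bounded_borel_mult bounded_borel_cnj)
  also have "\<dots> = (LINT z|\<mu> x. complex_of_real ((cmod (f z))\<^sup>2))"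
    by (rule Bochner_Integration.integral_cong) (simp_all add: complex_norm_square mult.commute del: of_real_power)
  also have "\<dots> = complex_of_real (LINT z|\<mu> x. (cmod (f z))\<^sup>2)"
    by (rule integral_complex_of_real)
  finally show ?thesis
    using of_real_eq_iff by blast
qed

lemma integrable_cmod_square:
  assumes f: "bounded_borel f"
  shows "integrable (\<mu> x) (\<lambda>z. (cmod (f z))\<^sup>2)"
proof -
  obtain M where "M > 0" "\<And>z. cmod (f z) \<le> M"
    using f by (metis bounded_borelE)
  then show ?thesis
    using bounded_borel_measurable[OF f]
    by (intro finite_measure.integrable_const_bound[OF finite_measure_mu, where B = "M\<^sup>2"]) auto
qed

lemma norm_Phi_le:
  assumes f: "bounded_borel f" and S: "S \<in> sets borel"
    and M: "M \<ge> 0" "\<And>z. z \<in> S \<Longrightarrow> cmod (f z) \<le> M" and x: "E S x = x"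
  shows "norm (\<Phi> f x) \<le> M * norm x"
proof -
  have 1: "integrable (\<mu> x) (\<lambda>z. (cmod (indicator S z * f z))\<^sup>2)"
    using f S by (intro integrable_cmod_square) auto
  \<comment> \<open>Since \<open>x\<close> lies in the range of \<open>E S\<close>, the function may
    be cut down to \<open>S\<close>, where the bound \<open>M\<close> is available.\<close>
  have "\<Phi> f x = \<Phi> (\<lambda>z. indicator S z * f z) x"
    using f S x Phi_Phi[OF f bounded_borel_indicator[OF S], of x]
    by (simp add: Phi_indicator mult.commute)
  then have "(norm (\<Phi> f x))\<^sup>2 = (LINT z|\<mu> x. (cmod (indicator S z * f z))\<^sup>2)"
    using f S by (simp add: norm_Phi bounded_borel_mult bounded_borel_indicator)
  also have "\<dots> \<le> (LINT z|\<mu> x. M\<^sup>2)"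
    using M finite_measure.integrable_const[OF finite_measure_mu]
    by (intro integral_mono 1) (auto simp: indicator_def intro!: power_mono)
  also have "\<dots> = (M * norm x)\<^sup>2"
    by (simp add: measure_mu power_mult_distrib)
  finally show ?thesis
    by (rule power2_le_imp_le) (use M in simp)
qed

lemma norm_Phi_ge:
  assumes f: "bounded_borel f" and S: "S \<in> sets borel"
    and m: "m \<ge> 0" "\<And>z. z \<in> S \<Longrightarrow> cmod (f z) \<ge> m"
  shows "norm (\<Phi> f x) \<ge> m * norm (E S x)"
proof -
  have "integrable (\<mu> x) (\<lambda>z. m\<^sup>2 * indicator S z)"
    by (intro integrable_mult_right integrable_real_indicator) (use S in \<open>simp_all add: emeasure_mu\<close>)
  have "(m * norm (E S x))\<^sup>2 = (LINT z|\<mu> x. m\<^sup>2 * indicator S z)"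
    using S by (simp add: measure_mu power_mult_distrib)
  also have "\<dots> \<le> (LINT z|\<mu> x. (cmod (f z))\<^sup>2)"
    by (intro integral_mono integrable_cmod_square f)
      (use m \<open>integrable (\<mu> x) (\<lambda>z. m\<^sup>2 * indicator S z)\<close> in \<open>auto simp: indicator_def intro!: power_mono\<close>)
  also have "\<dots> = (norm (\<Phi> f x))\<^sup>2"
    using f by (simp add: norm_Phi)
  finally show ?thesis
    by (rule power2_le_imp_le) simp
qed

end

section \<open>The spectrum as the support of the resolution of the identity\<close>

locale normal_resolution = pvm E
  for E :: "complex set \<Rightarrow> 'a::complex_hilbert_space \<Rightarrow> 'a" +
  fixes N :: "'a \<rightharpoonup> 'a"
  assumes normal: "normal_operator N"
    and N_eq: "N = spectral_integral E (\<lambda>z. z)"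
begin

lemma dom_N: "x \<in> dom N \<longleftrightarrow> (\<integral>\<^sup>+ z. ennreal ((cmod z)\<^sup>2) \<partial>\<mu> x) < \<infinity>"
  by (simp add: N_eq dom_def spectral_integral_def spectral_domain_def)

lemma N_linear: "linear_operator N"
  using normal by (simp add: normal_operator_def)

lemma dom_N_add: "x \<in> dom N \<Longrightarrow> y \<in> dom N \<Longrightarrow> x + y \<in> dom N"
  using N_linear unfolding linear_operator_def by blast

lemma dom_N_scaleC: "x \<in> dom N \<Longrightarrow> a *\<^sub>C x \<in> dom N"
  using N_linear unfolding linear_operator_def by blast

lemma N_diff:
  assumes "N x = Some u" "N y = Some v"
  shows "N (x - y) = Some (u - v)"
proof -
  have "N (- y) = Some (- v)"
    using N_linear assms(2) unfolding linear_operator_def by (metis scaleC_minus_one)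
  then have "N (x + - y) = Some (u + - v)"
    using N_linear assms(1) unfolding linear_operator_def by blast
  then show ?thesis
    by simp
qed

lemma N_closed:
  assumes "\<And>n::nat. N (X n) = Some (Y n)" "X \<longlonglongrightarrow> x" "Y \<longlonglongrightarrow> y"
  shows "N x = Some y"
proof -
  have "closed (Map.graph N)"
    using normal by (simp add: normal_operator_def)
  moreover have "\<And>n. (X n, Y n) \<in> Map.graph N"
    using assms(1) by (simp add: in_graphI)
  moreover have "(\<lambda>n. (X n, Y n)) \<longlonglongrightarrow> (x, y)"
    by (intro tendsto_Pair assms)
  ultimately have "(x, y) \<in> Map.graph N"
    by (rule closed_sequentially)
  then show ?thesis
    by (rule in_graphD)
qed

lemma spectral_domain_N: "spectral_domain E (\<lambda>z. z) = dom N"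
  unfolding spectral_domain_def using dom_N by blast

text \<open>On a finite measure, square integrability passes to \<open>z\<close> through
  \<open>norm z \<le> 1 + (norm z)\<^sup>2\<close>. This ensures that the integrals in the form of
  \<open>N\<close> are genuine and not the default value 0.\<close>

lemma integrable_dom_N:
  assumes "x \<in> dom N"
  shows "integrable (\<mu> x) (\<lambda>z. (cmod z)\<^sup>2)" "integrable (\<mu> x) (\<lambda>z. z)"
proof -
  show 1: "integrable (\<mu> x) (\<lambda>z. (cmod z)\<^sup>2)"
    using assms by (simp add: dom_N integrable_iff_bounded)
  have 2: "integrable (\<mu> x) (\<lambda>z. 1 + (cmod z)\<^sup>2)"
    using 1 finite_measure.integrable_const[OF finite_measure_mu, of x 1]
    by (intro Bochner_Integration.integrable_add) auto
  have le: "norm z \<le> norm (1 + (norm z)\<^sup>2)" for z :: complex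
  proof -
    have "2 * norm z \<le> 1 + (norm z)\<^sup>2"
      using sum_squares_bound[of 1 "norm z"] by simp
    then have "norm z \<le> 1 + (norm z)\<^sup>2"
      using norm_ge_zero[of z] by linarith
    then show ?thesis
      by simp
  qed
  show "integrable (\<mu> x) (\<lambda>z. z)"
    by (rule Bochner_Integration.integrable_bound[OF 2]) (use le in simp_all)
qed

section \<open>Action of the operator on the spectral subspaces of bounded sets\<close>

lemma bounded_borel_indicator_ident:
  assumes "S \<in> sets borel" "bounded S"
  shows "bounded_borel (\<lambda>z::complex. indicator S z * z)"
proof -
  obtain M where "\<And>z. z \<in> S \<Longrightarrow> cmod z \<le> M"
    using assms(2) by (auto simp: bounded_iff)
  then show ?thesis
    using assms(1) by (intro bounded_borelI[where M = "max M 0"]) (auto simp: indicator_def le_max_iff_disj)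
qed

lemma bounded_borel_indicator_shift:
  assumes "S \<in> sets borel" "bounded S"
  shows "bounded_borel (\<lambda>z::complex. indicator S z * (z - c))"
  using bounded_borel_diff[OF bounded_borel_indicator_ident[OF assms]
      bounded_borel_mult[OF bounded_borel_const[of c] bounded_borel_indicator[OF assms(1)]]]
  by (simp add: algebra_simps)

text \<open>The measure \<open>\<mu> x\<close> is concentrated on the bounded set \<open>S\<close>,
  so \<open>x\<close> is in the domain and only values of \<open>z\<close> on \<open>S\<close> enter
  the form. The value of \<open>N\<close> is then that of a bounded function, accessible to the
  calculus.\<close>

lemma N_on_bounded:
  assumes S: "S \<in> sets borel" "bounded S" and x: "E S x = x"
  shows "N x = Some (\<Phi> (\<lambda>z. indicator S z * z) x)"
proof -
  note b = bounded_borel_indicator_ident[OF S]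
  have "x \<in> dom N"
  proof -
    obtain M where M: "\<And>z. z \<in> S \<Longrightarrow> cmod z \<le> M"
      using S(2) by (auto simp: bounded_iff)
    have "(\<integral>\<^sup>+ z. ennreal ((cmod z)\<^sup>2) \<partial>\<mu> x) = (\<integral>\<^sup>+ z. ennreal ((cmod z)\<^sup>2) \<partial>density (\<mu> x) (indicator S))"
      using S(1) by (simp add: density_mu x)
    also have "\<dots> = (\<integral>\<^sup>+ z. indicator S z * ennreal ((cmod z)\<^sup>2) \<partial>\<mu> x)"
      using S(1) by (intro nn_integral_density) auto
    also have "\<dots> \<le> (\<integral>\<^sup>+ z. ennreal (M\<^sup>2) \<partial>\<mu> x)"
      by (intro nn_integral_mono) (auto simp: indicator_def intro!: ennreal_leI power_mono M)
    also have "\<dots> < \<infinity>"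
      by (simp add: emeasure_mu ennreal_mult_less_top)
    finally show ?thesis
      by (simp add: dom_N)
  qed
  let ?u = "\<Phi> (\<lambda>z. indicator S z * z) x"
  have u: "cinner y ?u = spectral_form E (\<lambda>z. z) y x" if "y \<in> dom N" for y
  proof -
    have "E (- S) x = 0"
      using E_compl[OF S(1), of x] x by simp
    have "integrable (\<mu> (x + \<i> ^ k *\<^sub>C y)) (\<lambda>z. z)" for k
      using \<open>x \<in> dom N\<close> that by (intro integrable_dom_N dom_N_add dom_N_scaleC)
    from spectral_form_split[OF S(1) _ this]
    have "spectral_form E (\<lambda>z. z) y x = spectral_form E (\<lambda>z. z) (E S y) (E S x)"
      by (simp add: \<open>E (- S) x = 0\<close>)
    also have "\<dots> = spectral_form E (\<lambda>z. indicator S z * z) y x"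
      using S(1) by (simp add: spectral_form_indicator_times)
    finally show ?thesis
      using b by (simp add: cinner_Phi)
  qed
  have "(THE u. \<forall>y\<in>dom N. cinner y u = spectral_form E (\<lambda>z. z) y x) = ?u"
  proof (rule the_equality)
    fix v assume v: "\<forall>y\<in>dom N. cinner y v = spectral_form E (\<lambda>z. z) y x"
    \<comment> \<open>Another candidate \<open>v\<close> differs from \<open>?u\<close> by a vector
      orthogonal to the dense domain, hence by zero.\<close>
    have "closure (dom N) = UNIV"
      using normal by (simp add: normal_operator_def)
    then obtain Y where Y: "\<And>n. Y n \<in> dom N" "Y \<longlonglongrightarrow> v - ?u"
      using closure_sequential[of "v - ?u" "dom N"] by auto
    have "(\<lambda>n. cinner (v - ?u) (Y n)) \<longlonglongrightarrow> cinner (v - ?u) (v - ?u)"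
      by (intro tendsto_cinner Y)
    moreover have "cinner (v - ?u) (Y n) = 0" for n
      using v u Y(1)[of n] by (subst cinner_commute) (simp add: cinner_diff_right)
    ultimately have "cinner (v - ?u) (v - ?u) = 0"
      by (simp add: LIMSEQ_const_iff)
    then show "v = ?u"
      by (simp add: cinner_norm)
  qed (use u in simp)
  with \<open>x \<in> dom N\<close> show ?thesis
    by (subst N_eq) (simp add: spectral_integral_def spectral_domain_N)
qed

lemma N_minus_on_bounded:
  assumes S: "S \<in> sets borel" "bounded S" and x: "E S x = x"
  shows "the (N x) - c *\<^sub>C x = \<Phi> (\<lambda>z. indicator S z * (z - c)) x"
proof -
  have "\<Phi> (\<lambda>z. indicator S z * z - c * indicator S z) x = the (N x) - c *\<^sub>C x"
    using S x N_on_bounded[OF assms]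
    by (simp add: Phi_diff bounded_borel_indicator_ident bounded_borel_indicator bounded_borel_mult
        bounded_borel_const Phi_mult Phi_indicator)
  then show ?thesis
    by (simp add: algebra_simps)
qed

lemma E_cball_tendsto: "(\<lambda>n. E (cball 0 (real n)) x) \<longlonglongrightarrow> x"
proof (rule E_incseq)
  show "(\<Union>n. cball (0::complex) (real n)) = UNIV"
    using real_arch_simple by (auto simp: set_eq_iff)
qed (auto simp: incseq_def)

text \<open>The truncations \<open>\<Phi> (indicator (cball 0 n) * z) x\<close> form a Cauchy sequence because
  \<open>cmod z ^ 2\<close> is \<open>\<mu> x\<close>-integrable; closedness of \<open>N\<close> identifies their limit.\<close>

lemma N_tendsto:
  assumes "N x = Some u"
  shows "(\<lambda>n. the (N (E (cball 0 (real n)) x))) \<longlonglongrightarrow> u"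
proof -
  define B :: "nat \<Rightarrow> complex set" where "B n = cball 0 (real n)" for n
  have B [measurable]: "B n \<in> sets borel" and B': "bounded (B n)" for n
    by (simp_all add: B_def)
  have EB: "E (B n) (E (B n) x) = E (B n) x" for n
    by (simp add: E_idem)
  let ?h = "\<lambda>n z. indicator (B n) z * z"
  have N_B: "N (E (B n) x) = Some (\<Phi> (?h n) x)" for n
  proof -
    have "\<Phi> (?h n) (\<Phi> (indicator (B n)) x) = \<Phi> (\<lambda>z. ?h n z * indicator (B n) z) x"
      by (rule Phi_Phi[OF bounded_borel_indicator_ident[OF B B'] bounded_borel_indicator[OF B]])
    also have "(\<lambda>z. ?h n z * indicator (B n) z) = ?h n"
      by (auto simp: indicator_def)
    finally show ?thesis
      using N_on_bounded[OF B B' EB] by (simp add: Phi_indicator)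
  qed
  have int: "integrable (\<mu> x) (\<lambda>z. (cmod z)\<^sup>2)"
    using assms by (intro integrable_dom_N) auto
  define a where "a n = (LINT z|\<mu> x. indicator (- B n) z * (cmod z)\<^sup>2)" for n
  have restr: "integrable (\<mu> x) (\<lambda>z. indicator T z * (cmod z)\<^sup>2)" if [measurable]: "T \<in> sets borel" for T
    by (rule Bochner_Integration.integrable_bound[OF int]) (auto simp: indicator_def)
  have "a \<longlonglongrightarrow> (LINT z|\<mu> x. 0)"
    unfolding a_def
  proof (rule integral_dominated_convergence[OF _ _ int])
    have "(\<lambda>n. indicator (- B n) z * (cmod z)\<^sup>2) \<longlonglongrightarrow> 0" for z
    proof (rule tendsto_eventually)
      obtain m where "cmod z \<le> real m"
        using real_arch_simple by blast
      then have "indicator (- B n) z = (0::real)" if "n \<ge> m" for n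
        using that by (simp add: B_def)
      then show "\<forall>\<^sub>F n in sequentially. indicator (- B n) z * (cmod z)\<^sup>2 = 0"
        unfolding eventually_sequentially by auto
    qed
    then show "AE z in \<mu> x. (\<lambda>n. indicator (- B n) z * (cmod z)\<^sup>2) \<longlonglongrightarrow> 0"
      by simp
  qed (auto simp: indicator_def)
  then have a: "a \<longlonglongrightarrow> 0"
    by simp
  have le: "(norm (\<Phi> (?h m) x - \<Phi> (?h n) x))\<^sup>2 \<le> a n" if "n \<le> m" for n m
  proof -
    have "(norm (\<Phi> (?h m) x - \<Phi> (?h n) x))\<^sup>2 = (LINT z|\<mu> x. (cmod (?h m z - ?h n z))\<^sup>2)"
      by (simp add: bounded_borel_indicator_ident[OF B B'] bounded_borel_diff flip: norm_Phi Phi_diff)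
    also have "\<dots> \<le> a n"
      unfolding a_def
      by (intro integral_mono restr integrable_cmod_square bounded_borel_diff
          bounded_borel_indicator_ident[OF B B'])
        (use that in \<open>auto simp: B_def indicator_def\<close>)
    finally show ?thesis .
  qed
  have "Cauchy (\<lambda>n. \<Phi> (?h n) x)"
  proof (rule CauchyI')
    fix e :: real assume "e > 0"
    then obtain k where k: "\<And>n. n \<ge> k \<Longrightarrow> a n < e\<^sup>2"
      using order_tendstoD(2)[OF a, of "e\<^sup>2"] by (auto simp: eventually_sequentially)
    have "dist (\<Phi> (?h m) x) (\<Phi> (?h n) x) < e" if "m \<ge> k" "m < n" for m n
    proof -
      have "(norm (\<Phi> (?h n) x - \<Phi> (?h m) x))\<^sup>2 < e\<^sup>2"
        using le[of m n] k[of m] that by simp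
      then have "norm (\<Phi> (?h n) x - \<Phi> (?h m) x) < e"
        by (rule power2_less_imp_less) (use \<open>e > 0\<close> in simp)
      then show ?thesis
        by (simp add: dist_norm norm_minus_commute)
    qed
    then show "\<exists>k. \<forall>m\<ge>k. \<forall>n>m. dist (\<Phi> (?h m) x) (\<Phi> (?h n) x) < e"
      by blast
  qed
  then obtain v where v: "(\<lambda>n. \<Phi> (?h n) x) \<longlonglongrightarrow> v"
    using Cauchy_convergent convergent_def by blast
  have "N x = Some v"
    by (rule N_closed[OF N_B _ v]) (simp add: B_def E_cball_tendsto)
  with assms v show ?thesis
    by (simp add: N_B flip: B_def)
qed

text \<open>Off the null set \<open>V\<close> one has \<open>cmod (z - c) \<ge> r\<close>. The
  calculus turns this into the estimate for the truncated vectors, and \<open>N_tendsto\<close>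
  carries it to every vector of the domain.\<close>

lemma N_bounded_below:
  assumes V: "V \<in> sets borel" "\<And>x. E V x = 0" and "ball c r \<subseteq> V" "r > 0" and u: "N x = Some u"
  shows "r * norm x \<le> norm (u - c *\<^sub>C x)"
proof (rule LIMSEQ_le)
  let ?B = "\<lambda>n. cball (0::complex) (real n)"
  show "(\<lambda>n. r * norm (E (?B n) x)) \<longlonglongrightarrow> r * norm x"
    by (intro tendsto_intros E_cball_tendsto)
  show "(\<lambda>n. norm (the (N (E (?B n) x)) - c *\<^sub>C E (?B n) x)) \<longlonglongrightarrow> norm (u - c *\<^sub>C x)"
    by (intro tendsto_intros N_tendsto u bounded_linear.tendsto[OF bounded_linear_scaleC] E_cball_tendsto)
  have "r * norm (E (?B n) x) \<le> norm (the (N (E (?B n) x)) - c *\<^sub>C E (?B n) x)" for n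
  proof -
    let ?y = "E (?B n) x"
    have EV: "E (- V) y = y" for y
      using E_compl[OF V(1), of y] V(2) by simp
    have far: "r \<le> cmod (z - c)" if "z \<notin> V" for z
      using \<open>ball c r \<subseteq> V\<close> that by (metis dist_commute dist_norm linorder_not_less mem_ball subsetD)
    have "bounded_borel (\<lambda>z. indicator (?B n) z * (z - c))"
      by (intro bounded_borel_indicator_shift) auto
    then have "r * norm (E (?B n \<inter> - V) ?y) \<le> norm (\<Phi> (\<lambda>z. indicator (?B n) z * (z - c)) ?y)"
      using V(1) \<open>r > 0\<close> far by (intro norm_Phi_ge) (auto simp: indicator_def)
    also have "E (?B n \<inter> - V) ?y = ?y"
      using V by (simp add: E_Int EV E_idem)
    finally show ?thesis
      by (simp add: N_minus_on_bounded[of "?B n"] E_idem)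
  qed
  then show "\<exists>n0. \<forall>n\<ge>n0. r * norm (E (?B n) x) \<le> norm (the (N (E (?B n) x)) - c *\<^sub>C E (?B n) x)"
    by blast
qed

text \<open>The inverse of \<open>N - c\<close> should be the integral of
  \<open>1 / (z - c)\<close>. Truncating that function to bounded sets gives vectors on which
  \<open>N\<close> is known; the lower bound makes them converge and closedness of \<open>N\<close>
  makes the limit a solution.\<close>

lemma resolvent_of_null:
  assumes V: "open V" "\<And>x. E V x = 0" and "c \<in> V"
  shows "c \<in> resolvent_set N"
proof -
  obtain r where r: "r > 0" "ball c r \<subseteq> V"
    using V(1) \<open>c \<in> V\<close> open_contains_ball by blast
  have Vb: "V \<in> sets borel"
    using V(1) by simp
  note below = N_bounded_below[OF Vb V(2) r(2,1)]
  let ?T = "\<lambda>x. the (N x) - c *\<^sub>C x"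
  have inj: "inj_on ?T (dom N)"
  proof (rule inj_onI)
    fix x y assume "x \<in> dom N" "y \<in> dom N" and eq: "?T x = ?T y"
    then obtain u v where uv: "N x = Some u" "N y = Some v"
      by blast
    then have "u - v - c *\<^sub>C (x - y) = 0"
      using eq by (simp add: scaleC_diff_right algebra_simps)
    then have "r * norm (x - y) \<le> 0"
      using below[OF N_diff[OF uv]] by simp
    with r(1) show "x = y"
      by (simp add: mult_le_0_iff)
  qed
  have surj: "\<exists>x u. N x = Some u \<and> u - c *\<^sub>C x = y" for y
  proof -
    \<comment> \<open>Removing \<open>V\<close> keeps \<open>z - c\<close> away from zero, so the
      reciprocal is bounded by \<open>inverse r\<close>; since \<open>E V\<close> vanishes, nothing
      is lost.\<close>
    define B :: "nat \<Rightarrow> complex set" where "B n = cball 0 (real n) - V" for n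
    have B: "B n \<in> sets borel" and B': "bounded (B n)" for n
      using Vb by (auto simp: B_def bounded_diff)
    define g where "g n z = indicator (B n) z * inverse (z - c)" for n z
    have g: "bounded_borel (g n)" for n
    proof (rule bounded_borelI)
      show "g n \<in> borel_measurable borel"
        unfolding g_def using B by measurable
      have "cmod (inverse (z - c)) \<le> inverse r" if "z \<in> B n" for z
      proof -
        have "r \<le> cmod (z - c)"
          using that r(2) unfolding B_def
          by (metis DiffD2 dist_commute dist_norm linorder_not_less mem_ball subsetD)
        then show ?thesis
          using r(1) by (simp add: norm_inverse le_imp_inverse_le)
      qed
      then show "cmod (g n z) \<le> inverse r" for z
        using r(1) by (auto simp: g_def indicator_def)
    qed
    define X where "X n = \<Phi> (g n) y" for n
    have EX: "E (B n) (X n) = X n" for n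
    proof -
      have "(\<lambda>z. indicator (B n) z * g n z) = g n"
        by (auto simp: g_def indicator_def)
      then show ?thesis
        using B g by (simp add: X_def E_Phi)
    qed
    have TX: "?T (X n) = E (cball 0 (real n)) y" for n
    proof -
      have bb: "bounded_borel (\<lambda>z. indicator (B n) z * (z - c))"
        using B B' by (intro bounded_borel_indicator_shift) auto
      have "?T (X n) = \<Phi> (\<lambda>z. indicator (B n) z * (z - c) * g n z) y"
        unfolding N_minus_on_bounded[OF B B' EX] unfolding X_def by (rule Phi_Phi[OF bb g])
      also have "(\<lambda>z. indicator (B n) z * (z - c) * g n z) = indicator (B n)"
        using \<open>c \<in> V\<close> by (auto simp: fun_eq_iff g_def indicator_def B_def intro!: right_inverse)
      also have "\<Phi> (indicator (B n)) y = E (cball 0 (real n)) (E (- V) y)"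
        using B Vb by (simp add: Phi_indicator B_def Diff_eq E_Int)
      also have "E (- V) y = y"
        using E_compl[OF Vb, of y] V(2) by simp
      finally show ?thesis .
    qed
    have NX: "N (X n) = Some (E (cball 0 (real n)) y + c *\<^sub>C X n)" for n
      using N_on_bounded[OF B B' EX, of n] TX[of n] by (simp add: algebra_simps)
    \<comment> \<open>The images of \<open>X n\<close> under \<open>N - c\<close> converge to
      \<open>y\<close>, and the lower bound transports the Cauchy property back to
      \<open>X\<close>.\<close>
    have "Cauchy X"
    proof (rule CauchyI)
      fix e :: real assume "e > 0"
      then have "r * e > 0"
        using r(1) by simp
      then obtain k where k: "\<And>m n. m \<ge> k \<Longrightarrow> n \<ge> k \<Longrightarrow>
          norm (E (cball 0 (real m)) y - E (cball 0 (real n)) y) < r * e"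
        using CauchyD[OF LIMSEQ_imp_Cauchy[OF E_cball_tendsto]] by blast
      have "norm (X m - X n) < e" if "m \<ge> k" "n \<ge> k" for m n
      proof -
        have "r * norm (X m - X n) \<le> norm (E (cball 0 (real m)) y - E (cball 0 (real n)) y)"
          using below[OF N_diff[OF NX[of m] NX[of n]]] by (simp add: scaleC_diff_right algebra_simps)
        also have "\<dots> < r * e"
          by (rule k[OF that])
        finally show ?thesis
          using r(1) by simp
      qed
      then show "\<exists>k. \<forall>m\<ge>k. \<forall>n\<ge>k. norm (X m - X n) < e"
        by blast
    qed
    then obtain x where x: "X \<longlonglongrightarrow> x"
      using Cauchy_convergent convergent_def by blast
    have "N x = Some (y + c *\<^sub>C x)"
      by (rule N_closed[OF NX x])
        (intro tendsto_intros E_cball_tendsto bounded_linear.tendsto[OF bounded_linear_scaleC] x)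
    then show ?thesis
      by (intro exI[of _ x] exI[of _ "y + c *\<^sub>C x"]) simp
  qed
  have bij: "bij_betw ?T (dom N) UNIV"
    unfolding bij_betw_def
  proof (intro conjI inj set_eqI iffI UNIV_I)
    fix y
    obtain x u where "N x = Some u" "u - c *\<^sub>C x = y"
      using surj by blast
    then show "y \<in> ?T ` dom N"
      by (intro image_eqI[of _ _ x]) auto
  qed
  let ?R = "inv_into (dom N) ?T"
  have R: "N (?R y) = Some (y + c *\<^sub>C ?R y)" for y
  proof -
    have "y \<in> ?T ` dom N"
      using bij by (simp add: bij_betw_def)
    from inv_into_into[OF this] f_inv_into_f[OF this] show ?thesis
      by (auto simp: algebra_simps)
  qed
  have R_eq: "?R y = x" if "N x = Some u" "u - c *\<^sub>C x = y" for x y u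
    using inv_into_f_f[OF inj, of x] that by auto
  have "bounded_linear ?R"
  proof (rule bounded_linear_intro[where K = "inverse r"])
    show "?R (x + y) = ?R x + ?R y" for x y
    proof (rule R_eq)
      show "N (?R x + ?R y) = Some ((x + c *\<^sub>C ?R x) + (y + c *\<^sub>C ?R y))"
        using N_linear R unfolding linear_operator_def by blast
    qed (simp add: scaleC_add_right algebra_simps)
    show "?R (a *\<^sub>R x) = a *\<^sub>R ?R x" for a x
    proof (rule R_eq)
      show "N (a *\<^sub>R ?R x) = Some (a *\<^sub>R (x + c *\<^sub>C ?R x))"
        using N_linear R unfolding linear_operator_def scaleR_scaleC by blast
    qed (simp add: scaleR_scaleC scaleC_scaleC scaleC_add_right mult.commute)
    show "norm (?R x) \<le> norm x * inverse r" for x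
      using below[OF R[of x]] r(1) by (simp add: field_simps)
  qed
  with bij show ?thesis
    by (simp add: resolvent_set_def)
qed

text \<open>On the range of \<open>E (ball c r)\<close> the operator \<open>N - c\<close> has norm
  at most \<open>r\<close>, while its inverse is bounded by \<open>K\<close>. With
  \<open>r = 1 / (2 * K)\<close> every vector \<open>v\<close> of that range satisfies
  \<open>norm v \<le> norm v / 2\<close>.\<close>

lemma null_of_resolvent:
  assumes "c \<in> resolvent_set N"
  shows "\<exists>r>0. \<forall>x. E (ball c r) x = 0"
proof -
  let ?T = "\<lambda>x. the (N x) - c *\<^sub>C x"
  let ?R = "inv_into (dom N) ?T"
  have bij: "bij_betw ?T (dom N) UNIV" and R: "bounded_linear ?R"
    using assms by (auto simp: resolvent_set_def)
  obtain K where K: "K > 0" "\<And>y. norm (?R y) \<le> norm y * K"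
    using bounded_linear.pos_bounded[OF R] by blast
  define r where "r = 1 / (2 * K)"
  have "r > 0"
    using K(1) by (simp add: r_def)
  moreover have "E (ball c r) x = 0" for x
  proof -
    let ?B = "ball c r"
    let ?v = "E ?B x"
    have EB: "E ?B ?v = ?v"
      by (simp add: E_idem)
    have Nv: "?v \<in> dom N"
      using N_on_bounded[of ?B ?v] EB by auto
    have bb: "bounded_borel (\<lambda>z. indicator ?B z * (z - c))"
      by (intro bounded_borel_indicator_shift) auto
    have "norm (?T ?v) \<le> r * norm ?v"
      unfolding N_minus_on_bounded[of ?B ?v, OF _ _ EB, simplified]
      using \<open>r > 0\<close> EB by (intro norm_Phi_le[OF bb, where S = ?B])
        (auto simp: dist_norm norm_minus_commute less_imp_le)
    then have "norm (?T ?v) * K \<le> r * norm ?v * K"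
      using K(1) by (intro mult_right_mono) auto
    then have "norm (?T ?v) * K \<le> norm ?v / 2"
      using K(1) by (simp add: r_def)
    moreover have "?R (?T ?v) = ?v"
      by (rule inv_into_f_f[OF bij_betw_imp_inj_on[OF bij] Nv])
    then have "norm ?v \<le> norm (?T ?v) * K"
      using K(2)[of "?T ?v"] by metis
    ultimately have "norm ?v \<le> norm ?v / 2"
      by linarith
    then show ?thesis
      by simp
  qed
  ultimately show ?thesis
    by blast
qed

text \<open>Every point of the resolvent set has a null ball around it, and open null sets consist
  of resolvent points. The union of all these sets may be uncountable; the Lindelof property reduces
  it to a countable one, on which the measures vanish.\<close>

lemma
  shows open_resolvent_set: "open (resolvent_set N)"
    and E_resolvent_set: "E (resolvent_set N) x = 0"
proof -
  let ?F = "{V. open V \<and> (\<forall>x. E V x = 0)}"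
  have U: "resolvent_set N = \<Union>?F"
  proof (intro equalityI subsetI)
    fix c assume "c \<in> resolvent_set N"
    then obtain r where "r > 0" "\<forall>x. E (ball c r) x = 0"
      using null_of_resolvent by blast
    then show "c \<in> \<Union>?F"
      by (intro UnionI[of "ball c r"]) auto
  qed (use resolvent_of_null in blast)
  then show "open (resolvent_set N)"
    by (simp add: open_Union)
  obtain F' where F': "F' \<subseteq> ?F" "countable F'" "\<Union>F' = \<Union>?F"
    using Lindelof[of ?F] by blast
  have "(\<Union>V\<in>F'. V) \<in> null_sets (\<mu> x)"
    using F'(1,2) by (intro null_sets_UN') (auto simp: null_sets_def emeasure_mu)
  then have "emeasure (\<mu> x) (resolvent_set N) = 0"
    using F'(3) by (simp add: U null_sets_def)
  then show "E (resolvent_set N) x = 0"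
    using \<open>open (resolvent_set N)\<close> by (simp add: emeasure_mu)
qed

end

section \<open>Bounds for the semigroup\<close>

locale contractive_normal_resolution = normal_resolution E N
  for E :: "complex set \<Rightarrow> 'a::complex_hilbert_space \<Rightarrow> 'a" and N +
  assumes spectral_bound: "(SUP z \<in> op_spectrum N. ereal (Re z)) = 0"
begin

abbreviation T :: "real \<Rightarrow> 'a \<Rightarrow> 'a" where
  "T \<equiv> exp_semigroup E N"

text \<open>The exponential is controlled only where \<open>Re z \<le> 0\<close>, which is known on
  the spectrum; the cutoff makes it bounded by 1 on the whole plane for
  \<open>t \<ge> 0\<close>.\<close>

definition symbol :: "real \<Rightarrow> complex \<Rightarrow> complex" where
  "symbol t z = indicator (op_spectrum N) z * exp (complex_of_real t * z)"

lemma spectrum_borel [measurable]: "op_spectrum N \<in> sets borel"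
  unfolding op_spectrum_def using open_resolvent_set by simp

lemma Re_spectrum_le: "z \<in> op_spectrum N \<Longrightarrow> Re z \<le> 0"
  using SUP_upper[of z "op_spectrum N" "\<lambda>z. ereal (Re z)"] by (simp add: spectral_bound)

text \<open>Allows a set to be cut down to the spectrum, where the symbol does not vanish and lower
  bounds for it hold.\<close>

lemma E_spectrum_Int:
  assumes "S \<in> sets borel"
  shows "E (S \<inter> op_spectrum N) x = E S x"
proof -
  have "E (op_spectrum N) x = x"
    using E_compl[of "resolvent_set N" x] open_resolvent_set
    by (simp add: E_resolvent_set op_spectrum_def)
  then show ?thesis
    using assms by (simp add: E_Int)
qed

lemma norm_symbol: "z \<in> op_spectrum N \<Longrightarrow> cmod (symbol t z) = exp (t * Re z)"
  by (simp add: symbol_def norm_exp_eq_Re)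

lemma bounded_borel_symbol:
  assumes "t \<ge> 0"
  shows "bounded_borel (symbol t)"
proof (rule bounded_borelI)
  show "symbol t \<in> borel_measurable borel"
    unfolding symbol_def
    by (intro borel_measurable_times borel_measurable_indicator spectrum_borel
        borel_measurable_continuous_onI continuous_intros)
  show "cmod (symbol t z) \<le> 1" for z
    using norm_symbol[of z t] Re_spectrum_le[of z] assms
    by (cases "z \<in> op_spectrum N") (auto simp: mult_nonneg_nonpos symbol_def)
qed

lemma T_eq_Phi:
  assumes "t \<ge> 0"
  shows "T t x = \<Phi> (symbol t) x"
proof -
  note b = bounded_borel_symbol[OF assms]
  have "spectral_domain E (symbol t) = UNIV"
    using integrable_cmod_square[OF b]
    by (auto simp: spectral_domain_def integrable_iff_bounded)
  then have "spectral_integral E (symbol t) x = Some (\<Phi> (symbol t) x)"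
    by (simp add: spectral_integral_def \<Phi>_def)
  then show ?thesis
    by (simp add: exp_semigroup_def symbol_def[abs_def])
qed

lemma T_bounded_linear:
  assumes "t \<ge> 0"
  shows "bounded_linear (T t)"
proof -
  have "T t = \<Phi> (symbol t)"
    using T_eq_Phi[OF assms] by blast
  then show ?thesis
    using Phi_bounded_linear[OF bounded_borel_symbol[OF assms]] by simp
qed

lemma continuous_norm_T: "t \<ge> 0 \<Longrightarrow> continuous_on UNIV (\<lambda>x. norm (T t x))"
  by (intro continuous_on_norm linear_continuous_on T_bounded_linear)

lemma halfplane_borel [measurable]:
  "{z::complex. Re z > a} \<in> sets borel" "{z::complex. Re z \<le> a} \<in> sets borel"
  by (simp_all add: open_halfspace_Re_gt closed_halfspace_Re_le)

lemma norm_T_ge: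
  assumes t: "t \<ge> 0"
  shows "exp (- t * \<delta>) * norm (E {z. Re z > - \<delta>} x) \<le> norm (T t x)"
proof -
  let ?S = "{z. Re z > - \<delta>} \<inter> op_spectrum N"
  have "exp (- t * \<delta>) * norm (E ?S x) \<le> norm (\<Phi> (symbol t) x)"
  proof (rule norm_Phi_ge[OF bounded_borel_symbol[OF t]])
    show "exp (- t * \<delta>) \<le> cmod (symbol t z)" if "z \<in> ?S" for z
      using that t mult_left_mono[of "- \<delta>" "Re z" t] by (simp add: norm_symbol)
  qed auto
  then show ?thesis
    by (simp add: E_spectrum_Int T_eq_Phi t)
qed

lemma norm_T_le:
  assumes t: "t \<ge> 0" and x: "E {z. Re z \<le> - \<delta>} x = x"
  shows "norm (T t x) \<le> exp (- t * \<delta>) * norm x"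
proof -
  have "norm (\<Phi> (symbol t) x) \<le> exp (- t * \<delta>) * norm x"
  proof (rule norm_Phi_le[OF bounded_borel_symbol[OF t] halfplane_borel(2) _ _ x])
    show "cmod (symbol t z) \<le> exp (- t * \<delta>)" if "z \<in> {z. Re z \<le> - \<delta>}" for z
      using that t mult_left_mono[of "Re z" "- \<delta>" t] norm_symbol[of z t]
      by (cases "z \<in> op_spectrum N") (auto simp: symbol_def)
  qed auto
  then show ?thesis
    by (simp add: T_eq_Phi t)
qed

text \<open>A vanishing projection would put the whole open half plane into the resolvent set, but
  the spectral bound 0 forces a spectral point in it.\<close>

lemma E_near_axis_nonzero:
  assumes "\<delta> > 0"
  shows "\<exists>x. E {z. Re z > - \<delta>} x \<noteq> 0"
proof -
  have "ereal (- \<delta>) < (SUP z \<in> op_spectrum N. ereal (Re z))"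
    using assms by (simp add: spectral_bound)
  then obtain z where z: "z \<in> op_spectrum N" "Re z > - \<delta>"
    by (auto simp: less_SUP_iff)
  then have "z \<notin> resolvent_set N"
    by (simp add: op_spectrum_def)
  then show ?thesis
    using resolvent_of_null[of "{z. Re z > - \<delta>}" z] z(2) by (auto simp: open_halfspace_Re_gt)
qed

lemma norm_T_attains:
  assumes "t \<ge> 0"
  shows "\<exists>x. norm x = 1 \<and> norm (T t x) \<ge> exp (- 1)"
proof -
  \<comment> \<open>The depth of the strip shrinks with \<open>t\<close> so that
    \<open>t * \<delta> \<le> 1\<close> and the lower bound stays above \<open>exp (- 1)\<close>
    uniformly; the \<open>+ 1\<close> admits \<open>t = 0\<close>.\<close>
  define \<delta> where "\<delta> = 1 / (t + 1)"
  have "\<delta> > 0" "t * \<delta> \<le> 1"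
    using assms by (simp_all add: \<delta>_def field_simps)
  let ?S = "{z. Re z > - \<delta>}"
  obtain y where "E ?S y \<noteq> 0"
    using E_near_axis_nonzero[OF \<open>\<delta> > 0\<close>] by blast
  define x where "x = (1 / norm (E ?S y)) *\<^sub>R E ?S y"
  have "norm x = 1"
    using \<open>E ?S y \<noteq> 0\<close> by (simp add: x_def)
  have "E ?S x = x"
    using bounded_linear.axioms(1)[OF E_bounded_linear[of ?S], THEN linear_scale]
    by (simp add: x_def E_idem)
  then have "exp (- t * \<delta>) \<le> norm (T t x)"
    using norm_T_ge[OF assms, of \<delta> x] \<open>norm x = 1\<close> by simp
  then have "exp (- 1) \<le> norm (T t x)"
    using \<open>t * \<delta> \<le> 1\<close> by (smt (verit) exp_le_cancel_iff mult_minus_left)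
  with \<open>norm x = 1\<close> show ?thesis
    by blast
qed

lemma stable_dense:
  assumes "stable_semigroup T"
  shows "(\<lambda>n. E {z. Re z \<le> - inverse (real (Suc n))} x) \<longlonglongrightarrow> x"
proof -
  \<comment> \<open>The closed right half plane is added so that the sets exhaust the plane,
    imaginary axis included. Its projection is zero: there the symbol has modulus at least 1 on the
    spectrum, which stability allows only for null vectors.\<close>
  let ?A = "\<lambda>n. {z. Re z \<le> - inverse (real (Suc n))} \<union> {z. Re z \<ge> 0}"
  have closed: "{z::complex. Re z \<ge> 0} \<in> sets borel"
    by (simp add: closed_halfspace_Re_ge)
  have 0: "E {z. Re z \<ge> 0} y = 0" for y
  proof -
    have "norm (E {z. Re z \<ge> 0} y) \<le> norm (T t y)" if "t \<ge> 0" for t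
    proof -
      have "norm (E {z. Re z \<ge> 0} y) \<le> norm (\<Phi> (symbol t) y)"
      proof -
        let ?S = "{z. Re z \<ge> 0} \<inter> op_spectrum N"
        have "1 * norm (E ?S y) \<le> norm (\<Phi> (symbol t) y)"
          using that closed by (intro norm_Phi_ge bounded_borel_symbol) (auto simp: norm_symbol)
        then show ?thesis
          using closed by (simp add: E_spectrum_Int)
      qed
      then show ?thesis
        using that by (simp add: T_eq_Phi)
    qed
    then have "\<forall>\<^sub>F t in at_top. norm (E {z. Re z \<ge> 0} y) \<le> norm (T t y)"
      by (intro eventually_mono[OF eventually_ge_at_top[of 0]])
    then have "norm (E {z. Re z \<ge> 0} y) \<le> 0"
      using assms unfolding stable_semigroup_def
      by (intro tendsto_lowerbound[of _ 0 at_top]) auto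
    then show ?thesis
      by simp
  qed
  have A: "?A n \<in> sets borel" for n
    using closed by (intro sets.Un halfplane_borel)
  have "(\<lambda>n. E (?A n) x) \<longlonglongrightarrow> x"
  proof (rule E_incseq)
    show "incseq ?A"
      by (auto simp: incseq_def intro: order_trans le_imp_inverse_le)
    have "\<exists>n. Re z \<le> - inverse (real (Suc n)) \<or> Re z \<ge> 0" for z
      using reals_Archimedean[of "- Re z"] by (smt (verit))
    then show "(\<Union>n. ?A n) = UNIV"
      by auto
  qed (use A in auto)
  moreover have "E (?A n) x = E {z. Re z \<le> - inverse (real (Suc n))} x" for n
  proof -
    have "E (- {z. Re z \<ge> 0}) y = y" for y
      using E_compl[OF closed, of y] 0[of y] by simp
    then have "E (?A n) x = E (?A n \<inter> - {z. Re z \<ge> 0}) x"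
      using A closed by (simp add: E_Int)
    also have "?A n \<inter> - {z. Re z \<ge> 0} = {z. Re z \<le> - inverse (real (Suc n))}"
    proof -
      have "- inverse (real (Suc n)) < 0"
        by simp
      then show ?thesis
        by (auto simp del: of_nat_Suc inverse_positive_iff_positive neg_less_0_iff_less)
    qed
    finally show ?thesis .
  qed
  ultimately show ?thesis
    by simp
qed

end

section \<open>Limit superior and limit inferior at infinity\<close>

text \<open>One integer bounds both the time and the value, which exhibits the condition as a
  countable intersection.\<close>

lemma Limsup_at_top_eq_infinity_iff:
  "Limsup at_top (\<lambda>t::real. ereal (f t)) = \<infinity> \<longleftrightarrow> (\<forall>n::nat. \<exists>t>real n. f t > real n)"
proof
  assume *: "Limsup at_top (\<lambda>t. ereal (f t)) = \<infinity>"
  show "\<forall>n::nat. \<exists>t>real n. f t > real n"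
  proof (rule ccontr)
    assume "\<not> ?thesis"
    then obtain n :: nat where "\<forall>t>real n. f t \<le> real n"
      by (metis not_less)
    then have "\<forall>\<^sub>F t in at_top. ereal (f t) \<le> ereal (real n)"
      by (intro eventually_mono[OF eventually_gt_at_top[of "real n"]]) auto
    then have "Limsup at_top (\<lambda>t. ereal (f t)) \<le> ereal (real n)"
      by (rule Limsup_bounded)
    with * show False
      by simp
  qed
next
  assume *: "\<forall>n::nat. \<exists>t>real n. f t > real n"
  show "Limsup at_top (\<lambda>t. ereal (f t)) = \<infinity>"
  proof (rule ccontr)
    assume "Limsup at_top (\<lambda>t. ereal (f t)) \<noteq> \<infinity>"
    then obtain m :: nat where "Limsup at_top (\<lambda>t. ereal (f t)) < ereal (real m)"
      using less_PInf_Ex_of_nat by (auto simp: less_top)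
    then have "\<forall>\<^sub>F t in at_top. f t < real m"
      by (auto dest!: Limsup_lessD)
    then obtain K where K: "\<And>t. t \<ge> K \<Longrightarrow> f t < real m"
      unfolding eventually_at_top_linorder by blast
    obtain n :: nat where "max K (real m) \<le> real n"
      using real_arch_simple by blast
    moreover obtain t where "t > real n" "f t > real n"
      using * by blast
    ultimately show False
      using K[of t] by auto
  qed
qed

text \<open>Nonnegativity is asked only for \<open>t \<ge> 0\<close>, where \<open>\<beta>\<close>
  is known to be positive; \<open>Suc n\<close> avoids the inverse of 0.\<close>

lemma Liminf_at_top_eq_zero_iff:
  fixes f :: "real \<Rightarrow> real"
  assumes nonneg: "\<And>t. t \<ge> 0 \<Longrightarrow> f t \<ge> 0"
  shows "Liminf at_top (\<lambda>t. ereal (f t)) = 0 \<longleftrightarrow> (\<forall>n::nat. \<exists>t>real n. f t < inverse (real (Suc n)))"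
proof
  assume *: "Liminf at_top (\<lambda>t. ereal (f t)) = 0"
  show "\<forall>n::nat. \<exists>t>real n. f t < inverse (real (Suc n))"
  proof (rule ccontr)
    assume "\<not> ?thesis"
    then obtain n :: nat where "\<forall>t>real n. f t \<ge> inverse (real (Suc n))"
      by (metis not_less)
    then have "\<forall>\<^sub>F t in at_top. ereal (inverse (real (Suc n))) \<le> ereal (f t)"
      by (intro eventually_mono[OF eventually_gt_at_top[of "real n"]]) auto
    then have "ereal (inverse (real (Suc n))) \<le> Liminf at_top (\<lambda>t. ereal (f t))"
      by (rule Liminf_bounded)
    with * show False
      by (simp del: of_nat_Suc)
  qed
next
  assume *: "\<forall>n::nat. \<exists>t>real n. f t < inverse (real (Suc n))"
  have "\<forall>\<^sub>F t in at_top. 0 \<le> ereal (f t)"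
    by (intro eventually_mono[OF eventually_ge_at_top[of 0]]) (simp add: nonneg)
  then have "0 \<le> Liminf at_top (\<lambda>t. ereal (f t))"
    by (rule Liminf_bounded)
  moreover have "\<not> 0 < Liminf at_top (\<lambda>t. ereal (f t))"
  proof
    assume "0 < Liminf at_top (\<lambda>t. ereal (f t))"
    then obtain e where e: "0 < ereal e" "ereal e < Liminf at_top (\<lambda>t. ereal (f t))"
      using ereal_dense2 by blast
    then have "\<forall>\<^sub>F t in at_top. f t > e"
      by (auto dest!: less_LiminfD)
    then obtain K where K: "\<And>t. t \<ge> K \<Longrightarrow> f t > e"
      unfolding eventually_at_top_linorder by blast
    obtain k where k: "inverse (real (Suc k)) < e"
      using reals_Archimedean e(1) by auto
    obtain m :: nat where m: "K \<le> real m"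
      using real_arch_simple by blast
    \<comment> \<open>The index \<open>max k m\<close> makes the time exceed \<open>K\<close> and
      the value fall below \<open>e\<close> at once.\<close>
    obtain t where t: "t > real (max k m)" "f t < inverse (real (Suc (max k m)))"
      using * by blast
    have "inverse (real (Suc (max k m))) \<le> inverse (real (Suc k))"
      by (intro le_imp_inverse_le) auto
    moreover have "K \<le> t"
      using t(1) m by simp
    ultimately show False
      using t(2) k K[of t] by linarith
  qed
  ultimately show "Liminf at_top (\<lambda>t. ereal (f t)) = 0"
    by auto
qed

section \<open>Genericity\<close>

context contractive_normal_resolution
begin

text \<open>Any \<open>x\<close> is perturbed at a single time \<open>t\<close> in two opposite
  directions. Since \<open>u\<close> is half the difference of \<open>x + u\<close> and
  \<open>x - u\<close>, one of these has an orbit value at least as large as that of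
  \<open>u\<close>.\<close>

lemma dense_large:
  assumes \<alpha>: "\<forall>t\<ge>0. \<alpha> t > 0" "filterlim \<alpha> at_top at_top"
  shows "closure {x. \<exists>t>real n. \<alpha> t * norm (T t x) > real n} = UNIV"
proof -
  have "\<exists>y\<in>{x. \<exists>t>real n. \<alpha> t * norm (T t x) > real n}. dist y x < e" if "e > 0" for x e
  proof -
    \<comment> \<open>The threshold is what \<open>\<alpha> t * (e / 2 * exp (- 1)) > real n\<close>
      demands: \<open>e / 2\<close> is the size of the perturbation and \<open>exp (- 1)\<close> the
      lower bound for the orbit of a unit vector.\<close>
    have "\<forall>\<^sub>F t in at_top. \<alpha> t > real n * exp 1 * (2 / e) \<and> t > real n"
      using \<alpha>(2) by (intro eventually_conj eventually_gt_at_top) (auto simp: filterlim_at_top_dense)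
    then obtain t where t: "\<alpha> t > real n * exp 1 * (2 / e)" "t > real n"
      by (auto simp: eventually_at_top_linorder)
    then have "t \<ge> 0" "\<alpha> t > 0"
      using \<alpha>(1) by auto
    obtain v where v: "norm v = 1" "norm (T t v) \<ge> exp (- 1)"
      using norm_T_attains[OF \<open>t \<ge> 0\<close>] by blast
    define u where "u = (e / 2) *\<^sub>R v"
    have lin: "linear (T t)"
      using T_bounded_linear[OF \<open>t \<ge> 0\<close>] by (rule bounded_linear.axioms)
    have "norm u < e"
      using v(1) that by (simp add: u_def)
    have "real n < \<alpha> t * norm (T t u)"
    proof -
      have "real n < \<alpha> t * (e / 2 * exp (- 1))"
        using t(1) that by (simp add: exp_minus field_simps)
      also have "\<dots> \<le> \<alpha> t * (e / 2 * norm (T t v))"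
        using v(2) that \<open>\<alpha> t > 0\<close> by (intro mult_left_mono) auto
      also have "e / 2 * norm (T t v) = norm (T t u)"
        using that by (simp add: u_def linear_scale[OF lin])
      finally show ?thesis .
    qed
    moreover have "2 *\<^sub>R T t u = T t (x + u) - T t (x - u)"
      by (simp add: linear_add[OF lin] linear_diff[OF lin] scaleR_2)
    then have "2 * norm (T t u) \<le> norm (T t (x + u)) + norm (T t (x - u))"
      by (metis norm_scaleR norm_triangle_ineq4 abs_numeral)
    then have "\<alpha> t * (2 * norm (T t u)) \<le> \<alpha> t * (norm (T t (x + u)) + norm (T t (x - u)))"
      using \<open>\<alpha> t > 0\<close> by (intro mult_left_mono) auto
    ultimately have "real n < \<alpha> t * norm (T t (x + u)) \<or> real n < \<alpha> t * norm (T t (x - u))"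
      by (simp add: algebra_simps) linarith
    moreover have "dist (x + u) x < e" "dist (x - u) x < e"
      using \<open>norm u < e\<close> by (simp_all add: dist_norm)
    ultimately show ?thesis
      using t(2) by blast
  qed
  then show ?thesis
    by (auto simp: closure_approachable)
qed

lemma dense_small:
  assumes stable: "stable_semigroup T"
    and \<beta>: "\<forall>\<epsilon>>0. ((\<lambda>t. \<beta> t * exp (- t * \<epsilon>)) \<longlongrightarrow> 0) at_top" "\<forall>t\<ge>0. \<beta> t > 0"
  shows "closure {x. \<exists>t>real n. \<beta> t * norm (T t x) < inverse (real (Suc n))} = UNIV"
proof -
  let ?V = "{x. \<exists>t>real n. \<beta> t * norm (T t x) < inverse (real (Suc n))}"
  have "E {z. Re z \<le> - inverse (real (Suc k))} x \<in> ?V" for k x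
  proof -
    define \<delta> where "\<delta> = inverse (real (Suc k))"
    have "\<delta> > 0"
      by (simp add: \<delta>_def)
    define y where "y = E {z. Re z \<le> - \<delta>} x"
    have y: "E {z. Re z \<le> - \<delta>} y = y"
      by (simp add: y_def E_idem)
    have "((\<lambda>t. \<beta> t * exp (- t * \<delta>) * norm y) \<longlongrightarrow> 0 * norm y) at_top"
      using \<beta>(1) \<open>\<delta> > 0\<close> by (intro tendsto_intros) auto
    then have "\<forall>\<^sub>F t in at_top. \<beta> t * exp (- t * \<delta>) * norm y < inverse (real (Suc n))"
      by (intro order_tendstoD) auto
    then have "\<forall>\<^sub>F t in at_top. \<beta> t * exp (- t * \<delta>) * norm y < inverse (real (Suc n)) \<and> t > real n"
      by (intro eventually_conj eventually_gt_at_top)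
    then obtain t where t: "\<beta> t * exp (- t * \<delta>) * norm y < inverse (real (Suc n))" "t > real n"
      by (auto simp: eventually_at_top_linorder)
    have "\<beta> t * norm (T t y) \<le> \<beta> t * (exp (- t * \<delta>) * norm y)"
      using t(2) \<beta>(2) norm_T_le[OF _ y, of t]
      by (intro mult_left_mono) (auto intro: less_imp_le)
    with t show ?thesis
      by (auto simp: mult.assoc y_def \<delta>_def simp del: of_nat_Suc)
  qed
  then have "x \<in> closure ?V" for x
    unfolding closure_sequential using stable_dense[OF stable, of x]
    by (intro exI[of _ "\<lambda>k. E {z. Re z \<le> - inverse (real (Suc k))} x"] conjI allI)
  then show ?thesis
    by blast
qed

text \<open>For a fixed time the condition is open in \<open>x\<close> because \<open>T t\<close> is
  bounded. The union over times preserves openness, so no regularity in \<open>t\<close>, in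
  particular none of the weights, is involved.\<close>

lemma open_orbit_set:
  assumes "\<And>t. open {r::real. P t r}"
  shows "open {x. \<exists>t>real n. P t (norm (T t x))}"
proof -
  have "open {x. P t (norm (T t x))}" if "t > real n" for t
    using continuous_norm_T[of t] that assms[of t]
    by (auto simp: continuous_on_open_vimage vimage_def)
  then have "open (\<Union>t\<in>{real n<..}. {x. P t (norm (T t x))})"
    by (intro open_UN) auto
  also have "(\<Union>t\<in>{real n<..}. {x. P t (norm (T t x))}) = {x. \<exists>t>real n. P t (norm (T t x))}"
    by auto
  finally show ?thesis .
qed

lemma decay_set_generic:
  assumes stable: "stable_semigroup T"
    and \<alpha>: "\<forall>t\<ge>0. \<alpha> t > 0" "filterlim \<alpha> at_top at_top"
    and \<beta>: "\<forall>t\<ge>0. \<beta> t > 0" "\<forall>\<epsilon>>0. ((\<lambda>t. \<beta> t * exp (- t * \<epsilon>)) \<longlongrightarrow> 0) at_top"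
  shows "gdelta_in euclidean (decay_set T \<alpha> \<beta>)" "closure (decay_set T \<alpha> \<beta>) = UNIV"
proof -
  define U where "U n = {x. \<exists>t>real n. \<alpha> t * norm (T t x) > real n}" for n
  define V where "V n = {x. \<exists>t>real n. \<beta> t * norm (T t x) < inverse (real (Suc n))}" for n
  have nonneg: "\<beta> t * norm (T t x) \<ge> 0" if "t \<ge> 0" for t x
    using \<beta>(1) that by (simp add: less_imp_le)
  have eq: "decay_set T \<alpha> \<beta> = \<Inter>(range U \<union> range V)"
  proof -
    have "decay_set T \<alpha> \<beta> = (\<Inter>n. U n) \<inter> (\<Inter>n. V n)"
      by (auto simp: decay_set_def Limsup_at_top_eq_infinity_iff Liminf_at_top_eq_zero_iff[OF nonneg]
          U_def V_def simp del: of_nat_Suc)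
    then show ?thesis
      by auto
  qed
  have count: "countable (range U \<union> range V)"
    by auto
  have "open (U n)" "open (V n)" for n
    unfolding U_def V_def
    by (intro open_orbit_set open_Collect_less continuous_intros)+
  moreover have "closure (U n) = UNIV" "closure (V n) = UNIV" for n
    unfolding U_def V_def using dense_large[OF \<alpha>] dense_small[OF stable \<beta>(2,1)] by auto
  ultimately have G: "open S" "closure S = UNIV" if "S \<in> range U \<union> range V" for S
    using that by auto
  show "gdelta_in euclidean (decay_set T \<alpha> \<beta>)"
    unfolding eq using count G(1) by (intro gdelta_in_Inter open_imp_gdelta_in) auto
  have "euclidean closure_of \<Inter>(range U \<union> range V) = topspace (euclidean :: 'a topology)"
  proof (rule Baire_category)
    show "completely_metrizable_space (euclidean :: 'a topology) \<or>
        locally_compact_space (euclidean :: 'a topology) \<and> regular_space (euclidean :: 'a topology)"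
      by (simp add: completely_metrizable_space_euclidean)
  qed (use count G in auto)
  then show "closure (decay_set T \<alpha> \<beta>) = UNIV"
    by (simp add: eq)
qed

lemma decay_set_exponential_not_dense:
  assumes \<gamma>: "\<forall>t\<ge>0. \<gamma> t > 0" and "\<epsilon> > 0"
    and Liminf: "Liminf at_top (\<lambda>t. ereal (\<gamma> t * exp (- t * \<epsilon>))) > 0"
  shows "closure (decay_set T \<alpha> \<gamma>) \<noteq> UNIV"
proof -
  let ?S = "{z. Re z > - \<epsilon>}"
  obtain c where c: "0 < ereal c" "ereal c < Liminf at_top (\<lambda>t. ereal (\<gamma> t * exp (- t * \<epsilon>)))"
    using ereal_dense2[OF Liminf] by blast
  then have ev: "\<forall>\<^sub>F t in at_top. c < \<gamma> t * exp (- t * \<epsilon>)"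
    by (auto dest: less_LiminfD)
  have "decay_set T \<alpha> \<gamma> \<subseteq> {x. E ?S x = 0}"
  proof
    fix x assume x: "x \<in> decay_set T \<alpha> \<gamma>"
    \<comment> \<open>The exponential growth of \<open>\<gamma>\<close> offsets the decay factor
      \<open>exp (- t * \<epsilon>)\<close> in \<open>norm_T_ge\<close>. A zero lower limit
      therefore forces \<open>E ?S x = 0\<close>.\<close>
    have "\<forall>\<^sub>F t in at_top. ereal (c * norm (E ?S x)) \<le> ereal (\<gamma> t * norm (T t x))"
      using ev eventually_ge_at_top[of 0]
    proof eventually_elim
      case (elim t)
      then have "c * norm (E ?S x) \<le> \<gamma> t * exp (- t * \<epsilon>) * norm (E ?S x)"
        by (intro mult_right_mono) auto
      also have "\<dots> \<le> \<gamma> t * norm (T t x)"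
        using \<gamma> elim norm_T_ge[of t \<epsilon> x] by (simp add: mult.assoc)
      finally show ?case
        by simp
    qed
    then have "ereal (c * norm (E ?S x)) \<le> Liminf at_top (\<lambda>t. ereal (\<gamma> t * norm (T t x)))"
      by (rule Liminf_bounded)
    then have "c * norm (E ?S x) \<le> 0"
      using x by (simp add: decay_set_def)
    then show "x \<in> {x. E ?S x = 0}"
      using c(1) by (simp add: mult_le_0_iff)
  qed
  moreover have "continuous_on UNIV (E ?S)"
    by (intro linear_continuous_on E_bounded_linear halfplane_borel)
  then have "closed {x. E ?S x = 0}"
    by (intro closed_Collect_eq continuous_on_const)
  ultimately have "closure (decay_set T \<alpha> \<gamma>) \<subseteq> {x. E ?S x = 0}"
    by (rule closure_minimal)
  then show ?thesis
    using E_near_axis_nonzero[OF \<open>\<epsilon> > 0\<close>] by blast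
qed

end

text \<open>Optimality is rendered by a positive lower limit of
  \<open>\<gamma> t * exp (- t * \<epsilon>)\<close> for some \<open>\<epsilon> > 0\<close>. An
  upper limit would not do: growth along some times only does not prevent small values along
  others.\<close>

theorem theorem1p2:
  fixes N :: "'a::complex_hilbert_space \<rightharpoonup> 'a"
    and E :: "complex set \<Rightarrow> 'a \<Rightarrow> 'a"
    and \<alpha> \<beta> :: "real \<Rightarrow> real"
  assumes "normal_operator N"
    and "resolution_of_identity E N"
    and "(SUP z \<in> op_spectrum N. ereal (Re z)) = 0"
    and "\<forall>t\<ge>0. \<alpha> t > 0" and "\<forall>t\<ge>0. \<beta> t > 0"
    and "filterlim \<alpha> at_top at_top"
    and "\<forall>\<epsilon>>0. ((\<lambda>t. \<beta> t * exp (- t * \<epsilon>)) \<longlongrightarrow> 0) at_top"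
    and "stable_semigroup (exp_semigroup E N)"
  shows "(gdelta_in euclidean (decay_set (exp_semigroup E N) \<alpha> \<beta>) \<and>
          closure (decay_set (exp_semigroup E N) \<alpha> \<beta>) = UNIV) \<and>
         (\<forall>\<gamma> :: real \<Rightarrow> real.
            (\<forall>t\<ge>0. \<gamma> t > 0) \<longrightarrow>
            (\<exists>\<epsilon>>0. Liminf at_top (\<lambda>t. ereal (\<gamma> t * exp (- t * \<epsilon>))) > 0) \<longrightarrow>
            closure (decay_set (exp_semigroup E N) \<alpha> \<gamma>) \<noteq> UNIV)"
proof -
  interpret contractive_normal_resolution E N
    using assms(1-3) by unfold_locales (auto simp: resolution_of_identity_def)
  show ?thesis
    using decay_set_generic[OF assms(8,4,6,5,7)] decay_set_exponential_not_dense by blast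
qed

end
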